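(* Let $G$ be a planar Hamiltonian graph, and let $\mathcal{P}^*(G)$ be the set of all plane geometric drawings of $G$ whose vertices are in strictly convex position. Then $\mathcal{P}^*(G)$ is not geometric-packable unless $G$ is (isomorphic to) the triangle $C_3$. Further, $\mathcal{P}^*(C_3)$ is geometric-packable.
   Context: Graphs are finite and simple; $v(G)$ and $e(G)$ denote the numbers of vertices and edges of $G$. A graph is Hamiltonian if it contains a Hamiltonian cycle; $C_k$ is the $k$-cycle. A geometric graph is a graph whose vertex set is a finite set of points in general position (no three on a line) in the Euclidean plane and whose edges are closed line segments with endpoints in the vertex set. It is plane if no two of its edges cross. A graph is planar if it has a plane geometric drawing, i.e. is isomorphic to a plane geometric graph. Two geometric graphs are congruent if one can be transformed into the other by a translation and/or a rotation. $\mathcal{P}^*(G)$ denotes the set of all plane geometric graphs whose underlying abstract graph is isomorphic to $G$ and whose vertices are in strictly convex position. Let $\mathcal{G}$ be a set of geometric graphs all having the same number of edges $e(\mathcal{G})$ (for $\mathcal{G}=\mathcal{P}^*(G)$ this is $e(G)$, also when $\mathcal{P}^*(G)$ is empty), and let $H$ be a geometric graph. A $\mathcal{G}$-packing of $H$ is a collection of pairwise edge-disjoint subgraphs of $H$, each congruent to some member of $\mathcal{G}$; $p(H,\mathcal{G})$ is the maximum size of a $\mathcal{G}$-packing of $H$. A sequence $\{H_n\}_{n\ge 1}$ of geometric graphs with $v(H_n)=n$ can be asymptotically packed by $\mathcal{G}$ if $\lim_{n\to\infty} p(H_n,\mathcal{G})\,e(\mathcal{G})/e(H_n)=1$. The set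 $\mathcal{G}$ is geometric-packable if every sequence $\{D_n\}_{n\ge1}$, where $D_n$ is a geometric drawing of the complete graph $K_n$ (a geometric graph on $n$ points in general position with all $\binom n2$ segments as edges), can be asymptotically packed by $\mathcal{G}$. *)

theory Defs
  imports "HOL-Analysis.Analysis"
begin

section \<open>Finite simple graphs\<close>

datatype 'a ugraph = UGraph (verts: "'a set") (edges: "'a set set")

definition simple_graph :: "'a ugraph \<Rightarrow> bool" where
  "simple_graph G \<longleftrightarrow> finite (verts G) \<and> (\<forall>e\<in>edges G. e \<subseteq> verts G \<and> card e = 2)"

definition subgraph :: "'a ugraph \<Rightarrow> 'a ugraph \<Rightarrow> bool" where
  "subgraph F H \<longleftrightarrow> simple_graph F \<and> verts F \<subseteq> verts H \<and> edges F \<subseteq> edges H"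

definition isomorphic :: "'a ugraph \<Rightarrow> 'b ugraph \<Rightarrow> bool" where
  "isomorphic G H \<longleftrightarrow> (\<exists>f. bij_betw f (verts G) (verts H) \<and>
     (\<forall>u\<in>verts G. \<forall>v\<in>verts G. {u, v} \<in> edges G \<longleftrightarrow> {f u, f v} \<in> edges H))"

text \<open>This is the \<open>k\<close>-cycle only for \<open>k \<ge> 3\<close>.\<close>

definition cycle_graph :: "nat \<Rightarrow> nat ugraph" where
  "cycle_graph k = UGraph {..<k} {{i, Suc i mod k} | i. i < k}"

definition hamiltonian :: "'a ugraph \<Rightarrow> bool" where
  "hamiltonian G \<longleftrightarrow> (\<exists>C k. k \<ge> 3 \<and> subgraph C G \<and> verts C = verts G \<and> isomorphic C (cycle_graph k))"


section \<open>Geometric graphs\<close>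

type_synonym point = "real ^ 2"

definition general_position :: "point set \<Rightarrow> bool" where
  "general_position S \<longleftrightarrow>
     (\<forall>a\<in>S. \<forall>b\<in>S. \<forall>c\<in>S. a \<noteq> b \<and> b \<noteq> c \<and> a \<noteq> c \<longrightarrow> \<not> collinear {a, b, c})"

text \<open>The edge drawn as the closed segment between \<open>a\<close> and \<open>b\<close> is represented by its set
  of endpoints \<open>{a, b}\<close>, which determines the segment and is determined by it.\<close>

definition geometric_graph :: "point ugraph \<Rightarrow> bool" where
  "geometric_graph H \<longleftrightarrow> simple_graph H \<and> general_position (verts H)"

text \<open>Vertices are in general position, so two distinct edges meet either not at all, or in a
  common endpoint, or in a point interior to both; only the last is a crossing.\<close>

definition crossing :: "point set \<Rightarrow> point set \<Rightarrow> bool" where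
  "crossing e e' \<longleftrightarrow> e \<noteq> e' \<and>
     (\<exists>a b c d. e = {a, b} \<and> e' = {c, d} \<and> open_segment a b \<inter> open_segment c d \<noteq> {})"

definition plane_graph :: "point ugraph \<Rightarrow> bool" where
  "plane_graph H \<longleftrightarrow> geometric_graph H \<and> (\<forall>e\<in>edges H. \<forall>e'\<in>edges H. \<not> crossing e e')"

definition planar :: "'a ugraph \<Rightarrow> bool" where
  "planar G \<longleftrightarrow> (\<exists>H. plane_graph H \<and> isomorphic H G)"

definition strictly_convex_position :: "point set \<Rightarrow> bool" where
  "strictly_convex_position S \<longleftrightarrow> (\<forall>v\<in>S. v extreme_point_of (convex hull S))"

definition plane_convex_drawings :: "'a ugraph \<Rightarrow> point ugraph set"  (\<open>\<P>\<^sup>*\<close>) where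
  "\<P>\<^sup>* G = {H. plane_graph H \<and> isomorphic H G \<and> strictly_convex_position (verts H)}"

text \<open>Reflections are excluded: \<^const>\<open>rotation_matrix\<close> requires determinant 1.\<close>

definition congruent_graph :: "point ugraph \<Rightarrow> point ugraph \<Rightarrow> bool" where
  "congruent_graph F H \<longleftrightarrow> (\<exists>(A :: real ^ 2 ^ 2) t. rotation_matrix A \<and>
     (let f = (\<lambda>x. A *v x + t) in verts H = f ` verts F \<and> edges H = (`) f ` edges F))"


section \<open>Packings\<close>

definition is_packing :: "point ugraph set \<Rightarrow> point ugraph \<Rightarrow> point ugraph set \<Rightarrow> bool" where
  "is_packing \<G> H P \<longleftrightarrow>
     (\<forall>F\<in>P. subgraph F H \<and> (\<exists>F'\<in>\<G>. congruent_graph F F')) \<and>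
     pairwise (\<lambda>F F'. disjnt (edges F) (edges F')) P"

text \<open>For finite \<open>H\<close>, the maximum is over a finite set, which contains 0 (the empty packing).\<close>

definition packing_number :: "point ugraph \<Rightarrow> point ugraph set \<Rightarrow> nat" where
  "packing_number H \<G> = Max (card ` {P. is_packing \<G> H P})"

text \<open>Below, \<open>m\<close> is the common number of edges of the members of \<open>\<G>\<close>. It is a parameter since
  \<open>\<G>\<close> may be empty.\<close>

definition asymptotically_packed ::
    "(nat \<Rightarrow> point ugraph) \<Rightarrow> point ugraph set \<Rightarrow> nat \<Rightarrow> bool" where
  "asymptotically_packed H \<G> m \<longleftrightarrow>
     (\<lambda>n. real (packing_number (H n) \<G>) * real m / real (card (edges (H n)))) \<longlonglongrightarrow> 1"

definition complete_drawing :: "nat \<Rightarrow> point ugraph \<Rightarrow> bool" where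
  "complete_drawing n D \<longleftrightarrow> geometric_graph D \<and> card (verts D) = n \<and>
     edges D = {e. e \<subseteq> verts D \<and> card e = 2}"

definition geometric_packable :: "point ugraph set \<Rightarrow> nat \<Rightarrow> bool" where
  "geometric_packable \<G> m \<longleftrightarrow>
     (\<forall>D. (\<forall>n\<ge>1. complete_drawing n (D n)) \<longrightarrow> asymptotically_packed D \<G> m)"

end

theory Submission
  imports Defs
begin

text \<open>Triangles: after numbering the points by \<open>\<int>/n\<close>, the triples of distinct points with sum 0
  are edge-disjoint and miss at most \<open>n\<close> of the edges.

  Other graphs: place the points in three clusters, each a nearly straight chain pointing at the
  centre, so that the line through any two points of a cluster separates the other two clusters.
  Then no convex quadrilateral meets all three clusters, so a plane convex copy of a Hamiltonian
  graph with \<open>k \<ge> 4\<close> vertices uses at most two of them. Its edges between the two clusters do not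
  cross, hence form a monotone chain of at most \<open>k - 1\<close> edges, and at most two of them, the extremal
  ones, lie on the Hamiltonian cycle. So at least \<open>k - 2\<close> edges, hence at least \<open>2/5\<close> of all edges of
  the copy, stay within a cluster. In the complete drawing only about \<open>1/3\<close> of the edges do, so that
  a packing covers at most a fraction \<open>5/6\<close> of the edges.\<close>

text \<open>Why three clusters: with two, about half of all edges would stay inside a cluster, more
  than the 2/5 that the copies demand, and nothing would follow. Three clusters lower the share to
  1/3, and strict convexity is what keeps a copy from spreading over all of them. The hypothesis k
  >= 4 acts twice: it supplies the fourth vertex that rules out a copy meeting three clusters, and
  it gives 2 (k - 1) <= 3 (k - 2), the inequality behind 2/5. Chords of G do no harm: noncrossing
  bounds all cross edges together by k - 1, while the inside edges of the cycle alone give k - 2.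
  All geometry of the clusters is expressed by signs of \<open>orient\<close>. The linear map that
  permutes the clusters is conjugate to the rotation by 120 degrees, but has integer entries and
  determinant 1, so that signs are computed once, for cluster 0, and without square roots. The
  chains are bent only because general position forbids straight ones.\<close>

section \<open>Orientation of point triples\<close>

text \<open>Twice the signed area of the triangle \<open>p q r\<close>, positive for a
  counterclockwise turn.\<close>

definition orient :: "point \<Rightarrow> point \<Rightarrow> point \<Rightarrow> real" where
  "orient p q r = (q $ 1 - p $ 1) * (r $ 2 - p $ 2) - (q $ 2 - p $ 2) * (r $ 1 - p $ 1)"

lemma orient_rotate: "orient q r p = orient p q r"
  by (simp add: orient_def algebra_simps)

lemma orient_swap: "orient q p r = - orient p q r"
  by (simp add: orient_def algebra_simps)

lemma orient_swap': "orient p r q = - orient p q r"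
  by (simp add: orient_def algebra_simps)

lemma orient_collinear:
  assumes "collinear {p, q, r}"
  shows "orient p q r = 0"
proof -
  obtain u where u: "\<And>x y. x \<in> {p, q, r} \<Longrightarrow> y \<in> {p, q, r} \<Longrightarrow> \<exists>c. x - y = c *\<^sub>R u"
    using assms unfolding collinear_def by blast
  obtain c where c: "q - p = c *\<^sub>R u" using u[of q p] by auto
  obtain d where d: "r - p = d *\<^sub>R u" using u[of r p] by auto
  have "q $ i - p $ i = c * u $ i" "r $ i - p $ i = d * u $ i" for i
    using arg_cong[OF c, of "\<lambda>x. x $ i"] arg_cong[OF d, of "\<lambda>x. x $ i"] by simp_all
  then show ?thesis by (simp add: orient_def)
qed

text \<open>Divided by their sum, the three orientations are the barycentric coordinates of
  \<open>x\<close>.\<close>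

lemma in_triangle_if_orient_pos:
  assumes "orient a b x > 0" "orient b c x > 0" "orient c a x > 0"
  shows "x \<in> convex hull {a, b, c}"
proof -
  define s where "s = orient b c x + orient c a x + orient a b x"
  have s: "s > 0" using assms by (simp add: s_def)
  have "s * x $ i = orient b c x * a $ i + orient c a x * b $ i + orient a b x * c $ i" for i
    using exhaust_2[of i] by (auto simp: s_def orient_def algebra_simps)
  then have "x $ i = orient b c x / s * a $ i + orient c a x / s * b $ i + orient a b x / s * c $ i" for i
    using s by (simp add: field_simps)
  then have "x = (orient b c x / s) *\<^sub>R a + (orient c a x / s) *\<^sub>R b + (orient a b x / s) *\<^sub>R c"
    by (simp add: vec_eq_iff)
  moreover have "orient b c x / s + orient c a x / s + orient a b x / s = 1"
    using s by (simp add: s_def flip: add_divide_distrib)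
  ultimately show ?thesis
    unfolding convex_hull_3 using assms s
    by (intro CollectI exI[of _ "orient b c x / s"] exI[of _ "orient c a x / s"]
        exI[of _ "orient a b x / s"]) simp
qed

text \<open>\<open>orient c d\<close> is affine along the line \<open>a b\<close> and changes sign
  between \<open>a\<close> and \<open>b\<close>, so it vanishes at a parameter \<open>s\<close>
  strictly inside; \<open>u\<close> arises in the same way on the other segment. It remains to see
  that both parameters give one point.\<close>

lemma open_segments_meet_if_orient:
  assumes "orient a b c * orient a b d < 0" "orient c d a * orient c d b < 0"
  shows "open_segment a b \<inter> open_segment c d \<noteq> {}"
proof -
  have ratio: "0 < p / (p - q) \<and> p / (p - q) < 1" if "p * q < 0" for p q :: real
    using that by (cases "p > 0") (auto simp: mult_less_0_iff field_simps)
  define s where "s = orient c d a / (orient c d a - orient c d b)"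
  define u where "u = orient a b c / (orient a b c - orient a b d)"
  have su: "0 < s" "s < 1" "0 < u" "u < 1"
    using ratio[OF assms(1)] ratio[OF assms(2)] by (auto simp: s_def u_def)
  have nz: "orient c d a - orient c d b \<noteq> 0" "orient a b c - orient a b d \<noteq> 0"
    using su s_def u_def by auto
  \<comment> \<open>Up to sign, both denominators are the cross product of \<open>b - a\<close> and
    \<open>d - c\<close>, so a single \<open>D\<close> clears them.\<close>
  have eq: "orient c d a - orient c d b = - (orient a b c - orient a b d)"
    by (simp add: orient_def algebra_simps)
  have "(1 - s) * a $ i + s * b $ i = (1 - u) * c $ i + u * d $ i" for i
  proof -
    define D where "D = orient a b c - orient a b d"
    have D: "D \<noteq> 0" using nz D_def by simp
    have sD: "s * D = - orient c d a" and uD: "u * D = orient a b c"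
      using D by (simp_all add: s_def u_def eq flip: D_def)
    have "D * ((1 - s) * a $ i + s * b $ i) = D * a $ i + (s * D) * (b $ i - a $ i)"
      by (simp add: algebra_simps)
    also have "\<dots> = D * c $ i + (u * D) * (d $ i - c $ i)"
      unfolding sD uD using exhaust_2[of i] by (auto simp: D_def orient_def algebra_simps)
    also have "\<dots> = D * ((1 - u) * c $ i + u * d $ i)"
      by (simp add: algebra_simps)
    finally show ?thesis using D by simp
  qed
  then have "(1 - s) *\<^sub>R a + s *\<^sub>R b = (1 - u) *\<^sub>R c + u *\<^sub>R d"
    by (simp add: vec_eq_iff)
  moreover have "a \<noteq> b" "c \<noteq> d" using assms by (auto simp: orient_def)
  ultimately show ?thesis
    using su unfolding in_segment(2) disjoint_iff by (metis in_segment(2))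
qed


section \<open>Plane Hamiltonian graphs on three chains\<close>

lemma Suc_mod_3_neq: "c < 3 \<Longrightarrow> Suc c mod 3 \<noteq> (c :: nat)"
  by presburger

lemma Suc_mod_3_cycle: "c < 3 \<Longrightarrow> Suc (Suc (Suc c mod 3) mod 3) mod 3 = (c :: nat)"
  by presburger

lemma Suc_mod_3_cases:
  assumes "x < 3" "c < 3"
  shows "x = c \<or> x = Suc c mod 3 \<or> x = Suc (Suc c mod 3) mod (3 :: nat)"
proof -
  have "x \<in> {0, 1, 2}" "c \<in> {0, 1, 2}" using assms by auto
  then show ?thesis by (elim insertE) simp_all
qed

text \<open>\<open>cl\<close> is the cluster and \<open>ht\<close> the position along its chain. A
  line through two points of a chain, directed towards larger \<open>ht\<close>, has the next
  cluster on its left and the previous one on its right. The shape of a single chain stays open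
  apart from noncollinearity.\<close>

locale three_chains =
  fixes S :: "point set" and cl :: "point \<Rightarrow> nat" and ht :: "point \<Rightarrow> real"
  assumes finite_S: "finite S"
    and cl_less: "x \<in> S \<Longrightarrow> cl x < 3"
    and ht_inj: "\<lbrakk>x \<in> S; y \<in> S; cl x = cl y; ht x = ht y\<rbrakk> \<Longrightarrow> x = y"
    and orient_next: "\<lbrakk>x \<in> S; y \<in> S; z \<in> S; cl y = cl x; cl z = Suc (cl x) mod 3; ht x < ht y\<rbrakk>
      \<Longrightarrow> orient x y z > 0"
    and orient_prev: "\<lbrakk>x \<in> S; y \<in> S; z \<in> S; cl y = cl x; cl x = Suc (cl z) mod 3; ht x < ht y\<rbrakk>
      \<Longrightarrow> orient x y z < 0"
    and orient_three: "\<lbrakk>x \<in> S; y \<in> S; z \<in> S; cl y = Suc (cl x) mod 3; cl z = Suc (cl y) mod 3\<rbrakk>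
      \<Longrightarrow> orient x y z > 0"
    and orient_nonzero: "\<lbrakk>x \<in> S; y \<in> S; z \<in> S; x \<noteq> y; y \<noteq> z; x \<noteq> z\<rbrakk> \<Longrightarrow> orient x y z \<noteq> 0"
begin

definition monochrome :: "point set \<Rightarrow> bool" where
  "monochrome e \<longleftrightarrow> (\<forall>x\<in>e. \<forall>y\<in>e. cl x = cl y)"

lemma monochrome_doubleton: "monochrome {x, y} \<longleftrightarrow> cl x = cl y"
  by (auto simp: monochrome_def)

end

text \<open>\<open>w\<close> runs along a Hamiltonian cycle, and \<open>E\<close> may contain
  further edges. Strict convexity is kept only in the form that no vertex lies in the hull of three
  others, which is enough to rule out both bad configurations below.\<close>

locale plane_hamiltonian_copy = three_chains +
  fixes V :: "point set" and E :: "point set set" and w :: "nat \<Rightarrow> point" and k :: nat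
  assumes V_sub: "V \<subseteq> S"
    and edge: "e \<in> E \<Longrightarrow> e \<subseteq> V \<and> card e = 2"
    and noncrossing: "\<lbrakk>{a, b} \<in> E; {c, d} \<in> E; a \<noteq> c; a \<noteq> d; b \<noteq> c; b \<noteq> d\<rbrakk>
      \<Longrightarrow> open_segment a b \<inter> open_segment c d = {}"
    and convex_position: "\<lbrakk>x \<in> V; a \<in> V; b \<in> V; c \<in> V; x \<notin> {a, b, c}\<rbrakk>
      \<Longrightarrow> x \<notin> convex hull {a, b, c}"
    and k_ge: "k \<ge> 4"
    and w_bij: "bij_betw w {..<k} V"
    and w_edge: "i < k \<Longrightarrow> {w i, w (Suc i mod k)} \<in> E"
begin

lemma finite_V: "finite V" and card_V: "card V = k"
  using finite_subset[OF V_sub finite_S] bij_betw_same_card[OF w_bij] by simp_all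

lemma finite_E: "finite E"
proof (rule finite_subset)
  show "E \<subseteq> Pow V" using edge by auto
qed (simp add: finite_V)

text \<open>The point of smaller \<open>ht\<close> lies in the triangle formed by the other point of
  its cluster and one point from each remaining cluster.\<close>

lemma no_rainbow_quad_less:
  assumes "x \<in> V" "y \<in> V" "b \<in> V" "c \<in> V"
    and "cl y = cl x" "cl b = Suc (cl x) mod 3" "cl c = Suc (cl b) mod 3" "ht x < ht y"
  shows False
proof -
  have S: "x \<in> S" "y \<in> S" "b \<in> S" "c \<in> S" using assms V_sub by auto
  have lt: "cl x < 3" "cl b < 3" "cl c < 3" using S cl_less by auto
  have cx: "cl x = Suc (cl c) mod 3"
    using Suc_mod_3_cycle[OF lt(1)] assms(6,7) by simp
  have neq: "cl x \<noteq> cl b" "cl x \<noteq> cl c"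
    using Suc_mod_3_neq[OF lt(1)] Suc_mod_3_neq[OF lt(3)] assms(6) cx by auto
  have "orient y b x > 0"
    using orient_next[OF S(1,2,3) assms(5,6,8)] orient_rotate[of y b x] by simp
  moreover have "orient b c x > 0"
    using orient_three[OF S(1,3,4) assms(6,7)] orient_rotate[of b c x] by simp
  moreover have "orient c y x > 0"
    using orient_prev[OF S(1,2,4) assms(5) cx assms(8)] orient_rotate[of y x c] orient_rotate[of x c y] orient_swap[of x y c]
    by simp
  ultimately have "x \<in> convex hull {y, b, c}" by (rule in_triangle_if_orient_pos)
  moreover have "x \<notin> {y, b, c}" using neq assms(8) by auto
  ultimately show False using convex_position assms(1-4) by blast
qed

lemma no_rainbow_quad:
  assumes "x \<in> V" "y \<in> V" "b \<in> V" "c \<in> V" "x \<noteq> y"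
    and "cl y = cl x" "cl b = Suc (cl x) mod 3" "cl c = Suc (cl b) mod 3"
  shows False
proof -
  have "ht x \<noteq> ht y" using ht_inj[of x y] assms V_sub by auto
  then consider "ht x < ht y" | "ht y < ht x" by linarith
  then show False
    using no_rainbow_quad_less[of x y b c] no_rainbow_quad_less[of y x b c] assms by cases auto
qed

text \<open>If all three clusters were met, a fourth vertex would share its cluster with one of
  three representatives. The two clusters are given as a cyclically consecutive pair, which fixes
  the signs of all later orientations.\<close>

lemma two_chains: "\<exists>c<3. \<forall>x\<in>V. cl x = c \<or> cl x = Suc c mod 3"
proof (rule ccontr)
  assume contra: "\<not> ?thesis"
  have ex: "\<exists>x\<in>V. cl x = c" if c: "c < 3" for c
  proof -
    have "Suc c mod 3 < 3" by simp
    then obtain x where x: "x \<in> V" "cl x \<noteq> Suc c mod 3" "cl x \<noteq> Suc (Suc c mod 3) mod 3"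
      using contra by blast
    have "cl x < 3" using x V_sub cl_less by auto
    then have "cl x = c" using x(2,3) c Suc_mod_3_cases by blast
    then show ?thesis using x by auto
  qed
  obtain x0 x1 x2 where x: "x0 \<in> V" "cl x0 = 0" "x1 \<in> V" "cl x1 = 1" "x2 \<in> V" "cl x2 = 2"
    using ex[of 0] ex[of 1] ex[of 2] by auto
  have "\<not> V \<subseteq> {x0, x1, x2}"
  proof
    assume "V \<subseteq> {x0, x1, x2}"
    then have "card V \<le> card {x0, x1, x2}" by (intro card_mono) auto
    also have "\<dots> \<le> 3" by (simp add: card_insert_if)
    finally show False using card_V k_ge by simp
  qed
  then obtain y where y: "y \<in> V" "y \<noteq> x0" "y \<noteq> x1" "y \<noteq> x2" by auto
  have "cl y < 3" using y V_sub cl_less by auto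
  then consider "cl y = 0" | "cl y = 1" | "cl y = 2" by linarith
  then show False
  proof cases
    case 1 then show False using no_rainbow_quad[of x0 y x1 x2] x y by simp
  next
    case 2 then show False using no_rainbow_quad[of x1 y x2 x0] x y by simp
  next
    case 3 then show False using no_rainbow_quad[of x2 y x0 x1] x y by simp
  qed
qed

text \<open>Both \<open>b\<close> and \<open>b'\<close> lie on one side of the line
  \<open>a a'\<close>, and both \<open>a\<close> and \<open>a'\<close> on one side of
  \<open>b b'\<close>; the signs make the two edges the diagonals of a convex quadrilateral.\<close>

lemma cross_edges_monotone:
  assumes "{a, b'} \<in> E" "{a', b} \<in> E" "cl a' = cl a" "cl b' = cl b" "cl b = Suc (cl a) mod 3"
    and "ht a < ht a'" "ht b < ht b'"
  shows False
proof -
  have S: "a \<in> S" "a' \<in> S" "b \<in> S" "b' \<in> S" using assms(1,2) edge V_sub by auto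
  have "cl a \<noteq> cl b" using Suc_mod_3_neq[OF cl_less[OF S(1)]] assms(5) by simp
  then have ne: "a \<noteq> a'" "a \<noteq> b" "b' \<noteq> a'" "b' \<noteq> b" using assms by auto
  have o: "orient a a' b > 0" "orient a a' b' > 0" "orient b b' a < 0" "orient b b' a' < 0"
    using orient_next[of a a'] orient_prev[of b b'] assms S by auto
  have rel: "orient a b' a' = - orient a a' b'" "orient a b' b = - orient b b' a"
    "orient a' b a = orient a a' b" "orient a' b b' = orient b b' a'"
    by (simp_all add: orient_def algebra_simps)
  have "orient a b' a' < 0" "orient a b' b > 0" "orient a' b a > 0" "orient a' b b' < 0"
    using o rel by linarith+
  then have "open_segment a b' \<inter> open_segment a' b \<noteq> {}"
    by (intro open_segments_meet_if_orient) (auto simp: mult_less_0_iff zero_less_mult_iff)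
  then show False using noncrossing[OF assms(1,2)] ne by auto
qed

text \<open>The middle point \<open>y\<close> of the chain cannot lie in the triangle \<open>x z p\<close>, so the segment \<open>y p\<close>
  passes through \<open>x z\<close>.\<close>

lemma chain_edge_not_over_cross_edge:
  assumes "{x, z} \<in> E" "{y, p} \<in> E" "cl y = cl x" "cl z = cl x"
    and p: "cl p = Suc (cl x) mod 3 \<or> cl x = Suc (cl p) mod 3"
    and "ht x < ht y" "ht y < ht z"
  shows False
proof -
  have V: "x \<in> V" "y \<in> V" "z \<in> V" "p \<in> V" using assms(1,2) edge by auto
  then have S: "x \<in> S" "y \<in> S" "z \<in> S" "p \<in> S" using V_sub by auto
  have "cl x \<noteq> cl p" using Suc_mod_3_neq[OF cl_less[OF S(1)]] Suc_mod_3_neq[OF cl_less[OF S(4)]] p by metis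
  then have ne: "x \<noteq> y" "x \<noteq> p" "z \<noteq> y" "z \<noteq> p" "y \<noteq> p" "x \<noteq> z"
    using assms(3,4,6,7) by auto
  have nin: "y \<notin> convex hull {x, z, p}" "y \<notin> convex hull {z, x, p}"
    using convex_position V ne by auto
  have nz: "orient x z y \<noteq> 0" using orient_nonzero S ne by auto
  have rel: "orient z p y = orient y z p" "orient p x y = orient x y p" "orient z x y = - orient x z y"
    "orient x p y = - orient x y p" "orient p z y = - orient y z p"
    "orient y p x = orient x y p" "orient y p z = - orient y z p"
    by (simp_all add: orient_def algebra_simps)
  have "open_segment x z \<inter> open_segment y p \<noteq> {}"
  proof (cases "cl p = Suc (cl x) mod 3")
    case True
    then have o: "orient x z p > 0" "orient x y p > 0" "orient y z p > 0"
      using orient_next[of x z p] orient_next[of x y p] orient_next[of y z p] assms(3,4,6,7) True S by auto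
    \<comment> \<open>A positive sign would put \<open>y\<close> into the triangle; so
      \<open>y\<close> and \<open>p\<close> lie on opposite sides of the line
      \<open>x z\<close>.\<close>
    then have "orient x z y < 0" using in_triangle_if_orient_pos[of x z y p] nin nz rel by force
    then show ?thesis using o rel by (intro open_segments_meet_if_orient) (auto simp: mult_less_0_iff zero_less_mult_iff)
  next
    case False
    then have prev: "cl x = Suc (cl p) mod 3" using p by blast
    have o: "orient x z p < 0" "orient x y p < 0" "orient y z p < 0"
      using orient_prev[of x z p] orient_prev[of x y p] orient_prev[of y z p] assms(3,4,6,7) prev S by auto
    then have "orient x z y > 0" using in_triangle_if_orient_pos[of z x y p] nin nz rel by force
    then show ?thesis using o rel by (intro open_segments_meet_if_orient) (auto simp: mult_less_0_iff zero_less_mult_iff)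
  qed
  then show False using noncrossing[OF assms(1,2)] ne by auto
qed

text \<open>Deleting two consecutive vertices of a cycle leaves a path, and a path cannot be split
  into two nonempty parts without an edge between them.\<close>

lemma cycle_connects_rest:
  assumes i: "i < k" and part: "V - {w i, w (Suc i mod k)} = L \<union> U" "L \<inter> U = {}"
    and ne: "L \<noteq> {}" "U \<noteq> {}"
  shows "\<exists>x\<in>L. \<exists>y\<in>U. {x, y} \<in> E"
proof (rule ccontr)
  assume no: "\<not> ?thesis"
  \<comment> \<open>Renumbering the cycle from \<open>i\<close> makes the deleted vertices
    \<open>g 0\<close> and \<open>g 1\<close>, and the path runs from \<open>g 2\<close> to
    \<open>g (k - 1)\<close>.\<close>
  define g where "g j = w ((i + j) mod k)" for j
  have k0: "k > 0" using k_ge by simp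
  have inj: "inj_on w {..<k}" and im: "w ` {..<k} = V" using w_bij by (auto simp: bij_betw_def)
  have gV: "g j \<in> V" for j using im k0 by (auto simp: g_def)
  have g_edge: "{g j, g (Suc j)} \<in> E" for j
    using w_edge[of "(i + j) mod k"] k0 by (simp add: g_def mod_Suc_eq)
  have g_inj: "j = l" if "g j = g l" "j < k" "l < k" for j l
  proof -
    have "(i + j) mod k = (i + l) mod k" using that(1) inj k0 by (auto simp: g_def inj_on_def)
    moreover have "((i + m) mod k + (k - i)) mod k = m mod k" for m
    proof -
      have "((i + m) mod k + (k - i)) mod k = (i + m + (k - i)) mod k" by (rule mod_add_left_eq)
      also have "i + m + (k - i) = m + k" using i by simp
      finally show ?thesis by simp
    qed
    ultimately have "j mod k = l mod k" by metis
    then show ?thesis using that by simp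
  qed
  have g_surj: "\<exists>j<k. g j = v" if v: "v \<in> V" for v
  proof -
    obtain l where l: "l < k" "w l = v" using v unfolding im[symmetric] by blast
    \<comment> \<open>The offset from \<open>i\<close> to \<open>l\<close> modulo \<open>k\<close>;
      the added \<open>k\<close> prevents truncation of the subtraction.\<close>
    have "(i + (l + k - i) mod k) mod k = (i + (l + k - i)) mod k" by (simp add: mod_add_right_eq)
    also have "\<dots> = l" using l i by simp
    finally show ?thesis using l k0 by (intro exI[of _ "(l + k - i) mod k"]) (simp add: g_def)
  qed
  have g01: "g 0 = w i" "g 1 = w (Suc i mod k)" using i by (simp_all add: g_def)
  have rest: "g j \<in> L \<union> U" if "2 \<le> j" "j < k" for j
    using gV[of j] g_inj[of j 0] g_inj[of j 1] that k_ge unfolding part(1)[symmetric] g01[symmetric] by force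
  \<comment> \<open>Without an edge between \<open>L\<close> and \<open>U\<close>, the whole path
    stays in the part that contains \<open>g 2\<close>.\<close>
  have all: "g j \<in> M" if "2 \<le> j" "j < k" "g 2 \<in> M" "M = L \<or> M = U" for j M
    using that
  proof (induction j rule: nat_induct_at_least)
    case (Suc j)
    then have "g j \<in> M" "g (Suc j) \<in> L \<union> U" using rest by auto
    then show ?case using g_edge[of j] no Suc.prems(3) by (metis Un_iff insert_commute)
  qed
  have idx: "\<exists>j. 2 \<le> j \<and> j < k \<and> g j = v" if "v \<in> L \<union> U" for v
  proof -
    have v: "v \<in> V" "v \<noteq> g 0" "v \<noteq> g 1" using that part(1) g01 by auto
    then obtain j where j: "j < k" "g j = v" using g_surj by auto
    moreover have "j \<noteq> 0" "j \<noteq> 1" using j v by metis+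
    ultimately show ?thesis by (intro exI[of _ j]) auto
  qed
  have "g 2 \<in> L \<or> g 2 \<in> U" using rest[of 2] k_ge by auto
  then show False
  proof
    assume "g 2 \<in> L"
    then show False using ne(2) idx all[of _ L] part(2) by blast
  next
    assume "g 2 \<in> U"
    then show False using ne(1) idx all[of _ U] part(2) by blast
  qed
qed

text \<open>A cross edge of the cycle that is not extremal would separate the remaining vertices.\<close>

lemma cycle_cross_edge_extremal:
  assumes i: "i < k" and e: "{w i, w (Suc i mod k)} = {a, b}" and ab: "cl b = Suc (cl a) mod 3"
    and two: "\<And>x. x \<in> V \<Longrightarrow> cl x = cl a \<or> cl x = cl b"
  shows "(\<forall>x\<in>V. (cl x = cl a \<longrightarrow> ht a \<le> ht x) \<and> (cl x = cl b \<longrightarrow> ht b \<le> ht x)) \<or>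
         (\<forall>x\<in>V. (cl x = cl a \<longrightarrow> ht x \<le> ht a) \<and> (cl x = cl b \<longrightarrow> ht x \<le> ht b))"
proof (rule ccontr)
  assume contra: "\<not> ?thesis"
  \<comment> \<open>\<open>L\<close> and \<open>U\<close> are the vertices below and above the edge
    \<open>a b\<close>, each measured in its own chain. If the edge is not extremal, both are
    nonempty.\<close>
  define L where "L = {x \<in> V. cl x = cl a \<and> ht x < ht a \<or> cl x = cl b \<and> ht x < ht b}"
  define U where "U = {x \<in> V. cl x = cl a \<and> ht a < ht x \<or> cl x = cl b \<and> ht b < ht x}"
  have abE: "{a, b} \<in> E" using w_edge[OF i] e by simp
  then have V: "a \<in> V" "b \<in> V" using edge by auto
  have clne: "cl a \<noteq> cl b" using Suc_mod_3_neq[of "cl a"] cl_less[of a] V V_sub ab by auto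
  have a_only: "x = a" if "x \<in> V" "cl x = cl a" "ht x = ht a" for x using ht_inj[of x a] that V V_sub by auto
  have b_only: "x = b" if "x \<in> V" "cl x = cl b" "ht x = ht b" for x using ht_inj[of x b] that V V_sub by auto
  have "x \<in> V - {a, b} \<longleftrightarrow> x \<in> L \<union> U" for x
  proof
    assume x: "x \<in> V - {a, b}"
    show "x \<in> L \<union> U"
    proof (cases "cl x = cl a")
      case True
      then have "ht x \<noteq> ht a" using a_only x by blast
      then show ?thesis using x True by (auto simp: L_def U_def)
    next
      case False
      then have "cl x = cl b" using two x by blast
      moreover from this have "ht x \<noteq> ht b" using b_only x by blast
      ultimately show ?thesis using x by (auto simp: L_def U_def)
    qed
  next
    assume "x \<in> L \<union> U"
    then show "x \<in> V - {a, b}" using clne by (auto simp: L_def U_def)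
  qed
  then have "V - {a, b} = L \<union> U" by blast
  then have part: "V - {w i, w (Suc i mod k)} = L \<union> U" using e by simp
  have disj: "L \<inter> U = {}" using clne by (auto simp: L_def U_def)
  have "L \<noteq> {}" "U \<noteq> {}" using contra by (auto simp: L_def U_def not_le)
  from cycle_connects_rest[OF i part disj this] obtain x y
    where xy: "x \<in> L" "y \<in> U" "{x, y} \<in> E" by blast
  have ba: "{b, a} \<in> E" "{y, x} \<in> E" using abE xy(3) by (simp_all add: insert_commute)
  \<comment> \<open>In the first two cases the edge \<open>x y\<close> skips over \<open>a\<close>
    or \<open>b\<close> within one chain; in the other two it joins the chains in the order opposite
    to \<open>a b\<close>. Either way it crosses \<open>a b\<close>.\<close>
  consider "cl x = cl a" "cl y = cl a" | "cl x = cl b" "cl y = cl b"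
    | "cl x = cl a" "cl y = cl b" | "cl x = cl b" "cl y = cl a"
    using xy two by (auto simp: L_def U_def)
  then show False
  proof cases
    case 1
    then show False using chain_edge_not_over_cross_edge[OF xy(3) abE] xy ab clne by (auto simp: L_def U_def)
  next
    case 2
    then show False using chain_edge_not_over_cross_edge[OF xy(3) ba(1)] xy ab clne by (auto simp: L_def U_def)
  next
    case 3
    then show False using cross_edges_monotone[OF xy(3) abE] xy ab clne by (auto simp: L_def U_def)
  next
    case 4
    then show False using cross_edges_monotone[OF abE ba(2)] xy ab clne by (auto simp: L_def U_def)
  qed
qed

text \<open>A coincidence of two steps in opposite directions would give i = i + 2 modulo
  \<open>k\<close>. So the cycle really has \<open>k\<close> edges.\<close>

lemma cycle_edges_inj: "inj_on (\<lambda>i. {w i, w (Suc i mod k)}) {..<k}"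
proof (rule inj_onI)
  fix i j assume ij: "i \<in> {..<k}" "j \<in> {..<k}" "{w i, w (Suc i mod k)} = {w j, w (Suc j mod k)}"
  have inj: "inj_on w {..<k}" using w_bij by (simp add: bij_betw_def)
  have lt: "i < k" "j < k" "Suc i mod k < k" "Suc j mod k < k" using ij k_ge by auto
  from ij(3) consider "w i = w j" | "w i = w (Suc j mod k)" "w (Suc i mod k) = w j"
    by (auto simp: doubleton_eq_iff)
  then show "i = j"
  proof cases
    case 1
    then show ?thesis using inj lt by (auto dest: inj_onD)
  next
    case 2
    then have "i = Suc j mod k" "Suc i mod k = j" using inj lt by (auto dest: inj_onD)
    then show ?thesis using k_ge lt by (auto simp: mod_Suc split: if_splits)
  qed
qed

text \<open>The rank sum \<open>f\<close> is injective on the chain of cross edges, and the extremal ones have the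
  least and the greatest possible rank sum.\<close>

lemma cross_le_monochrome: "2 * card {e \<in> E. \<not> monochrome e} \<le> 3 * card {e \<in> E. monochrome e}"
proof -
  obtain c where c: "c < 3" and two: "\<And>x. x \<in> V \<Longrightarrow> cl x = c \<or> cl x = Suc c mod 3"
    using two_chains by blast
  define A where "A = {x \<in> V. cl x = c}"
  define B where "B = {x \<in> V. cl x = Suc c mod 3}"
  define R where "R = {(a, b). a \<in> A \<and> b \<in> B \<and> {a, b} \<in> E}"
  define rk where "rk M x = card {y \<in> M. ht y < ht x}" for M and x :: point
  define f where "f = (\<lambda>(a, b). rk A a + rk B b)"
  have cne: "c \<noteq> Suc c mod 3" using Suc_mod_3_neq[OF c] by simp
  have fin: "finite A" "finite B" using finite_V by (auto simp: A_def B_def)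
  have V_AB: "V = A \<union> B" "A \<inter> B = {}" using two cne by (auto simp: A_def B_def)
  have card_AB: "card A + card B = k"
    using card_Un_disjoint[OF fin V_AB(2)] V_AB(1) card_V by simp
  have finR: "finite R" by (rule finite_subset[of _ "A \<times> B"]) (auto simp: R_def fin)
  have rk_mono: "rk M x \<le> rk M y" if "ht x \<le> ht y" "finite M" for M x y
    unfolding rk_def using that by (intro card_mono) auto
  have rk_less: "rk M x < rk M y" if "ht x < ht y" "finite M" "x \<in> M" for M x y
    unfolding rk_def using that by (intro psubset_card_mono) auto
  have rk_bound: "rk M x < card M" if "finite M" "x \<in> M" for M x
    unfolding rk_def using that by (intro psubset_card_mono) auto
  have injA: "x = y" if "x \<in> A" "y \<in> A" "ht x = ht y" for x y
    using that ht_inj[of x y] V_sub by (auto simp: A_def)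
  have injB: "x = y" if "x \<in> B" "y \<in> B" "ht x = ht y" for x y
    using that ht_inj[of x y] V_sub by (auto simp: B_def)
  have chain: "ht b \<le> ht b'" if "(a, b) \<in> R" "(a', b') \<in> R" "ht a < ht a'" for a b a' b'
  proof (rule ccontr)
    assume "\<not> ht b \<le> ht b'"
    then show False using cross_edges_monotone[of a b a' b'] that by (auto simp: R_def A_def B_def)
  qed
  \<comment> \<open>Along the chain of cross edges one endpoint moves strictly up and the other
    never moves down, so the rank sum increases.\<close>
  have f_less: "f (a, b) < f (a', b')" if "(a, b) \<in> R" "(a', b') \<in> R" "ht a < ht a'" for a b a' b'
    using chain[OF that] rk_less[of a a' A] rk_mono[of b b' B] that fin
    by (force simp: f_def R_def)
  have f_inj: "inj_on f R"
  proof (rule inj_onI, clarify)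
    fix a b a' b' assume ab: "(a, b) \<in> R" "(a', b') \<in> R" "f (a, b) = f (a', b')"
    have "ht a = ht a'" using f_less[OF ab(1,2)] f_less[OF ab(2,1)] ab(3) by linarith
    then have a: "a = a'" using injA ab by (auto simp: R_def)
    have "\<not> ht b < ht b'" "\<not> ht b' < ht b"
      using rk_less[of b b' B] rk_less[of b' b B] ab fin a by (auto simp: f_def R_def)
    then show "a = a' \<and> b = b'" using a injB ab by (auto simp: R_def)
  qed
  have card_R: "card R \<le> k - 1"
  proof -
    \<comment> \<open>Ranks begin at 0, so the largest rank sum is (|A| - 1) + (|B| - 1) = k - 2,
      which leaves k - 1 values.\<close>
    have "f ` R \<subseteq> {..<k - 1}"
      using rk_bound[OF fin(1)] rk_bound[OF fin(2)] card_AB by (force simp: f_def R_def)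
    then have "card (f ` R) \<le> k - 1" using card_mono[of "{..<k - 1}"] by fastforce
    then show ?thesis using card_image[OF f_inj] by simp
  qed
  have cross_form: "\<exists>a b. (a, b) \<in> R \<and> e = {a, b}" if e: "e \<in> E" "\<not> monochrome e" for e
  proof -
    obtain x y where xy: "x \<in> e" "y \<in> e" "cl x \<noteq> cl y" using e by (auto simp: monochrome_def)
    have "card e = 2" "e \<subseteq> V" using edge e by auto
    then have exy: "e = {x, y}" using xy by (metis card_2_iff doubleton_eq_iff empty_iff insert_iff)
    have "x \<in> A \<and> y \<in> B \<or> y \<in> A \<and> x \<in> B"
      using two[of x] two[of y] subsetD[OF \<open>e \<subseteq> V\<close>, of x] subsetD[OF \<open>e \<subseteq> V\<close>, of y] xy
      by (auto simp: A_def B_def)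
    then have "(x, y) \<in> R \<or> (y, x) \<in> R" using e exy by (auto simp: R_def insert_commute)
    moreover have "e = {y, x}" using exy by (simp add: insert_commute)
    ultimately show ?thesis using exy by blast
  qed
  have card_cross: "card {e \<in> E. \<not> monochrome e} \<le> card R"
  proof -
    have "{e \<in> E. \<not> monochrome e} \<subseteq> (\<lambda>(a, b). {a, b}) ` R" using cross_form by fastforce
    then show ?thesis using surj_card_le[OF finR] by blast
  qed
  define C where "C = (\<lambda>i. {w i, w (Suc i mod k)}) ` {..<k}"
  have C: "C \<subseteq> E" "card C = k" "finite C"
    using w_edge card_image[OF cycle_edges_inj] by (auto simp: C_def)
  \<comment> \<open>The cross edges that belong to the Hamiltonian cycle. Since \<open>f\<close> is
    injective, at most two of them can take the two extreme values.\<close>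
  define Q where "Q = {(a, b) \<in> R. {a, b} \<in> C}"
  have "f (a, b) \<in> {0, k - 2}" if ab: "(a, b) \<in> Q" for a b
  proof -
    obtain i where i: "i < k" "{w i, w (Suc i mod k)} = {a, b}" using ab by (auto simp: Q_def C_def)
    have abAB: "a \<in> A" "b \<in> B" using ab by (auto simp: Q_def R_def)
    then have clab: "cl a = c" "cl b = Suc c mod 3" by (auto simp: A_def B_def)
    from cycle_cross_edge_extremal[OF i] two
    consider "\<forall>x\<in>A. ht a \<le> ht x" "\<forall>x\<in>B. ht b \<le> ht x" | "\<forall>x\<in>A. ht x \<le> ht a" "\<forall>x\<in>B. ht x \<le> ht b"
      unfolding clab A_def B_def by blast
    then show ?thesis
    proof cases
      case 1
      then have "{y \<in> A. ht y < ht a} = {}" "{y \<in> B. ht y < ht b} = {}" by fastforce+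
      then show ?thesis by (simp add: f_def rk_def del: Collect_empty_eq)
    next
      case 2
      have "{y \<in> A. ht y < ht a} = A - {a}" "{y \<in> B. ht y < ht b} = B - {b}"
        using 2 injA injB abAB by (auto simp: less_le)
      then have "f (a, b) = (card A - 1) + (card B - 1)" using abAB fin by (simp add: f_def rk_def)
      moreover have "card A > 0" "card B > 0" using abAB fin by (auto simp: card_gt_0_iff)
      ultimately have "f (a, b) = k - 2" using card_AB by linarith
      then show ?thesis by simp
    qed
  qed
  then have "f ` Q \<subseteq> {0, k - 2}" by (metis image_subsetI surj_pair)
  then have "card (f ` Q) \<le> card {0, k - 2}" by (intro card_mono) auto
  also have "\<dots> \<le> 2" by (simp add: card_insert_if)
  finally have card_Q: "card Q \<le> 2"
    using card_image[OF inj_on_subset[OF f_inj], of Q] by (force simp: Q_def)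
  have "{e \<in> C. \<not> monochrome e} \<subseteq> (\<lambda>(a, b). {a, b}) ` Q" using cross_form C(1) by (fastforce simp: Q_def)
  moreover have "finite Q" by (rule finite_subset[OF _ finR]) (auto simp: Q_def)
  ultimately have crossC: "card {e \<in> C. \<not> monochrome e} \<le> 2" using surj_card_le card_Q le_trans by blast
  have "card C = card ({e \<in> C. monochrome e} \<union> {e \<in> C. \<not> monochrome e})" by (rule arg_cong[of _ _ card]) auto
  also have "\<dots> = card {e \<in> C. monochrome e} + card {e \<in> C. \<not> monochrome e}"
    using C by (intro card_Un_disjoint) auto
  finally have "k \<le> card {e \<in> C. monochrome e} + 2" using C crossC by simp
  moreover have "card {e \<in> C. monochrome e} \<le> card {e \<in> E. monochrome e}"
    using C finite_E by (intro card_mono) auto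
  \<comment> \<open>At most k - 1 cross edges against at least k - 2 inside ones; 2 (k - 1) <= 3 (k
    - 2) holds from k = 4 on, with equality there.\<close>
  ultimately show ?thesis using card_cross card_R k_ge by linarith
qed

end


section \<open>Isomorphism and congruence\<close>

definition complete_graph :: "'a set \<Rightarrow> 'a ugraph" where
  "complete_graph V = UGraph V {e. e \<subseteq> V \<and> card e = 2}"

lemma complete_graph_sel [simp]:
  "verts (complete_graph V) = V" "edges (complete_graph V) = {e. e \<subseteq> V \<and> card e = 2}"
  by (simp_all add: complete_graph_def)

lemma simple_complete_graph: "finite V \<Longrightarrow> simple_graph (complete_graph V)"
  by (simp add: simple_graph_def)

lemma isomorphic_complete_graph:
  assumes "bij_betw f V W"
  shows "isomorphic (complete_graph V) (complete_graph W)"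
  unfolding isomorphic_def
proof (intro exI[of _ f] conjI ballI)
  fix u v assume "u \<in> verts (complete_graph V)" "v \<in> verts (complete_graph V)"
  then show "{u, v} \<in> edges (complete_graph V) \<longleftrightarrow> {f u, f v} \<in> edges (complete_graph W)"
    using assms by (auto simp: bij_betw_def card_insert_if dest: inj_onD)
qed (use assms in simp)

text \<open>As a complete graph, the triangle admits every bijection of its vertices as an
  isomorphism, so no cyclic order has to be chosen.\<close>

lemma cycle_graph_3: "cycle_graph 3 = complete_graph {..<3}"
proof -
  have "{{i, Suc i mod 3} | i. i < 3} = {e. e \<subseteq> {..<3 :: nat} \<and> card e = 2}" (is "?L = ?R")
  proof (intro equalityI subsetI)
    fix e assume "e \<in> ?L"
    then obtain i where i: "e = {i, Suc i mod 3}" "i < 3" by auto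
    then have "i \<in> {0, 1, 2}" by auto
    then show "e \<in> ?R" using i(1) by (elim insertE) auto
  next
    fix e assume "e \<in> ?R"
    then obtain a b where e: "e = {a, b}" "a \<noteq> b" "a < 3" "b < 3" by (auto simp: card_2_iff)
    then have "a \<in> {0, 1, 2}" "b \<in> {0, 1, 2}" by auto
    then consider "{a, b} = {0, Suc 0 mod 3}" | "{a, b} = {1, Suc 1 mod 3}" | "{a, b} = {2, Suc 2 mod 3}"
      using e(2) by (elim insertE) (auto simp: insert_commute numeral_2_eq_2)
    then show "e \<in> ?L"
    proof cases
      case 1 then show ?thesis using e(1) by (intro CollectI exI[of _ 0]) simp
    next
      case 2 then show ?thesis using e(1) by (intro CollectI exI[of _ 1]) simp
    next
      case 3 then show ?thesis using e(1) by (intro CollectI exI[of _ 2]) simp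
    qed
  qed
  then show ?thesis by (simp add: cycle_graph_def complete_graph_def)
qed

lemma isomorphic_trans:
  assumes "isomorphic G H" "isomorphic H K"
  shows "isomorphic G K"
proof -
  obtain f where f: "bij_betw f (verts G) (verts H)"
    "\<And>u v. u \<in> verts G \<Longrightarrow> v \<in> verts G \<Longrightarrow> {u, v} \<in> edges G \<longleftrightarrow> {f u, f v} \<in> edges H"
    using assms(1) by (auto simp: isomorphic_def)
  obtain g where g: "bij_betw g (verts H) (verts K)"
    "\<And>u v. u \<in> verts H \<Longrightarrow> v \<in> verts H \<Longrightarrow> {u, v} \<in> edges H \<longleftrightarrow> {g u, g v} \<in> edges K"
    using assms(2) by (auto simp: isomorphic_def)
  show ?thesis unfolding isomorphic_def
    using bij_betw_trans[OF f(1) g(1)] f(2) g(2) bij_betw_apply[OF f(1)]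
    by (intro exI[of _ "g \<circ> f"]) auto
qed

lemma isomorphic_sym:
  assumes "isomorphic G H"
  shows "isomorphic H G"
proof -
  obtain f where f: "bij_betw f (verts G) (verts H)"
    "\<And>u v. u \<in> verts G \<Longrightarrow> v \<in> verts G \<Longrightarrow> {u, v} \<in> edges G \<longleftrightarrow> {f u, f v} \<in> edges H"
    using assms(1) by (auto simp: isomorphic_def)
  let ?g = "inv_into (verts G) f"
  have "?g x \<in> verts G" "f (?g x) = x" if "x \<in> verts H" for x
    using f(1) that by (auto simp: bij_betw_def inv_into_into f_inv_into_f)
  then show ?thesis unfolding isomorphic_def
    using bij_betw_inv_into[OF f(1)] f(2) by (intro exI[of _ ?g]) auto
qed

text \<open>\<open>isomorphic\<close> only compares sets of the form {u, v}; simplicity of both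
  graphs ensures that every edge is one.\<close>

lemma isomorphic_card_edges:
  assumes iso: "isomorphic G H" and G: "simple_graph G" and H: "simple_graph H"
  shows "card (edges G) = card (edges H)"
proof -
  obtain f where f: "bij_betw f (verts G) (verts H)"
    "\<And>u v. u \<in> verts G \<Longrightarrow> v \<in> verts G \<Longrightarrow> {u, v} \<in> edges G \<longleftrightarrow> {f u, f v} \<in> edges H"
    using iso by (auto simp: isomorphic_def)
  have "(`) f ` edges G = edges H"
  proof (intro equalityI subsetI)
    fix e' assume "e' \<in> (`) f ` edges G"
    then obtain e where e: "e \<in> edges G" "e' = f ` e" by auto
    then have "card e = 2" "e \<subseteq> verts G" using G by (auto simp: simple_graph_def)
    then obtain u v where "e = {u, v}" "u \<in> verts G" "v \<in> verts G" by (auto simp: card_2_iff)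
    then show "e' \<in> edges H" using f(2)[of u v] e by auto
  next
    fix e' assume e': "e' \<in> edges H"
    then have "card e' = 2" "e' \<subseteq> verts H" using H by (auto simp: simple_graph_def)
    then obtain x y where xy: "e' = {x, y}" "x \<in> verts H" "y \<in> verts H" by (auto simp: card_2_iff)
    then obtain u v where uv: "u \<in> verts G" "v \<in> verts G" "x = f u" "y = f v"
      using f(1) unfolding bij_betw_def by blast
    then have "{u, v} \<in> edges G" using f(2) e' xy by auto
    moreover have "e' = f ` {u, v}" using xy uv by auto
    ultimately show "e' \<in> (`) f ` edges G" by blast
  qed
  moreover have "inj_on ((`) f) (edges G)"
  proof (rule inj_on_subset)
    show "inj_on ((`) f) (Pow (verts G))" using f(1) by (simp add: bij_betw_def inj_on_image_Pow)
    show "edges G \<subseteq> Pow (verts G)" using G by (auto simp: simple_graph_def)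
  qed
  ultimately show ?thesis using card_image by fastforce
qed

lemma rotation_affine_inj:
  fixes A :: "real ^ 2 ^ 2"
  assumes "rotation_matrix A"
  shows "inj (\<lambda>x. A *v x + t)"
proof (rule injI)
  fix x y assume "A *v x + t = A *v y + t"
  then have "transpose A *v (A *v x) = transpose A *v (A *v y)" by simp
  then show "x = y"
    using assms by (simp add: rotation_matrix_def orthogonal_matrix matrix_vector_mul_assoc)
qed

lemma congruent_graph_refl: "congruent_graph F F"
proof -
  have "(\<lambda>x :: point. (mat 1 :: real ^ 2 ^ 2) *v x + 0) = id" by auto
  moreover have "rotation_matrix (mat 1 :: real ^ 2 ^ 2)"
    by (simp add: rotation_matrix_def orthogonal_matrix_id)
  ultimately show ?thesis
    unfolding congruent_graph_def
    by (intro exI[of _ "mat 1"] exI[of _ 0]) simp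
qed

lemma congruent_graph_isomorphic:
  assumes "congruent_graph F H"
  shows "isomorphic F H"
proof -
  obtain A t f where f: "rotation_matrix A" "f = (\<lambda>x. A *v x + t)"
    and H: "verts H = f ` verts F" "edges H = (`) f ` edges F"
    using assms by (auto simp: congruent_graph_def Let_def)
  have inj: "inj f" using rotation_affine_inj f by simp
  have "{u, v} \<in> edges F \<longleftrightarrow> {f u, f v} \<in> edges H" for u v
  proof -
    have "{f u, f v} = f ` {u, v}" by simp
    moreover have "inj ((`) f)" using inj by (intro injI) (simp add: inj_image_eq_iff)
    ultimately show ?thesis unfolding H(2) by (metis inj_image_mem_iff)
  qed
  then show ?thesis
    unfolding isomorphic_def using inj H(1)
    by (intro exI[of _ f]) (auto simp: bij_betw_def intro: inj_on_subset)
qed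


section \<open>Counting edges in packings\<close>

lemma finite_edges: "simple_graph G \<Longrightarrow> finite (edges G)"
  unfolding simple_graph_def by (metis PowI finite_Pow_iff finite_subset subsetI)

lemma finite_subgraphs:
  assumes "simple_graph H"
  shows "finite {F. subgraph F H}"
proof (rule finite_subset)
  show "{F. subgraph F H} \<subseteq> (\<lambda>(V, E). UGraph V E) ` (Pow (verts H) \<times> Pow (edges H))"
  proof
    fix F assume "F \<in> {F. subgraph F H}"
    then show "F \<in> (\<lambda>(V, E). UGraph V E) ` (Pow (verts H) \<times> Pow (edges H))"
      by (cases F) (auto simp: subgraph_def)
  qed
  show "finite ((\<lambda>(V, E). UGraph V E) ` (Pow (verts H) \<times> Pow (edges H)))"
    using assms finite_edges by (auto simp: simple_graph_def)
qed

lemma finite_packing: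
  assumes "simple_graph H" "is_packing \<G> H P"
  shows "finite P"
  by (rule finite_subset[OF _ finite_subgraphs[OF assms(1)]]) (use assms(2) in \<open>auto simp: is_packing_def\<close>)

lemma finite_packings:
  assumes "simple_graph H"
  shows "finite {P. is_packing \<G> H P}"
proof (rule finite_subset)
  show "{P. is_packing \<G> H P} \<subseteq> Pow {F. subgraph F H}" by (auto simp: is_packing_def)
qed (simp add: finite_subgraphs assms)

lemma card_le_packing_number:
  assumes "simple_graph H" "is_packing \<G> H P"
  shows "card P \<le> packing_number H \<G>"
  unfolding packing_number_def using assms by (intro Max_ge) (auto simp: finite_packings)

lemma packing_number_attained:
  assumes "simple_graph H"
  shows "\<exists>P. is_packing \<G> H P \<and> card P = packing_number H \<G>"
proof -
  have "is_packing \<G> H {}" by (simp add: is_packing_def)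
  then have "packing_number H \<G> \<in> card ` {P. is_packing \<G> H P}"
    unfolding packing_number_def using assms by (intro Max_in) (auto simp: finite_packings)
  then show ?thesis by auto
qed

text \<open>Used with \<open>Q\<close> always true to bound triangle packings from above, and with
  \<open>monochrome\<close> for the obstruction.\<close>

lemma packing_edges_le:
  assumes H: "simple_graph H" and P: "is_packing \<G> H P"
    and m: "\<And>F. F \<in> P \<Longrightarrow> m \<le> card {e \<in> edges F. Q e}"
  shows "card P * m \<le> card {e \<in> edges H. Q e}"
proof -
  have sub: "edges F \<subseteq> edges H" "finite (edges F)" if "F \<in> P" for F
    using P that finite_edges by (auto simp: is_packing_def subgraph_def)
  have "card P * m \<le> (\<Sum>F\<in>P. card {e \<in> edges F. Q e})"
    using sum_bounded_below[of P m "\<lambda>F. card {e \<in> edges F. Q e}"] m by simp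
  also have "\<dots> = card (\<Union>F\<in>P. {e \<in> edges F. Q e})"
  proof (rule card_UN_disjoint[symmetric])
    show "\<forall>F\<in>P. \<forall>F'\<in>P. F \<noteq> F' \<longrightarrow> {e \<in> edges F. Q e} \<inter> {e \<in> edges F'. Q e} = {}"
    proof (intro ballI impI)
      fix F F' assume "F \<in> P" "F' \<in> P" "F \<noteq> F'"
      then have "disjnt (edges F) (edges F')" using P by (auto simp: is_packing_def pairwise_def)
      then show "{e \<in> edges F. Q e} \<inter> {e \<in> edges F'. Q e} = {}" by (auto simp: disjnt_def)
    qed
  qed (use finite_packing[OF H P] sub in auto)
  also have "\<dots> \<le> card {e \<in> edges H. Q e}"
    using sub finite_edges[OF H] by (intro card_mono) auto
  finally show ?thesis .
qed

lemma complete_drawing_eq: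
  assumes "complete_drawing n D"
  shows "D = complete_graph (verts D)"
  using assms by (cases D) (auto simp: complete_drawing_def complete_graph_def)

lemma complete_drawing_card_edges:
  assumes "complete_drawing n D"
  shows "card (edges D) = n choose 2"
proof -
  have "finite (verts D)" "card (verts D) = n" "edges D = {e. e \<subseteq> verts D \<and> card e = 2}"
    using assms unfolding complete_drawing_def geometric_graph_def simple_graph_def by blast+
  then show ?thesis by (simp add: n_subsets)
qed


section \<open>Packing triangles\<close>

lemma adjacent_open_segments_disjoint:
  assumes "\<not> collinear {p, q, r :: point}"
  shows "open_segment p q \<inter> open_segment p r = {}"
proof (rule ccontr)
  assume "open_segment p q \<inter> open_segment p r \<noteq> {}"
  then obtain s u where su: "0 < s" "0 < u" "(1 - s) *\<^sub>R p + s *\<^sub>R q = (1 - u) *\<^sub>R p + u *\<^sub>R r"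
    by (auto simp: in_segment)
  then have "s *\<^sub>R (q - p) = u *\<^sub>R (r - p)" by (simp add: algebra_simps)
  then have "(1 / u) *\<^sub>R s *\<^sub>R (q - p) = (1 / u) *\<^sub>R u *\<^sub>R (r - p)" by simp
  then have "r - p = (s / u) *\<^sub>R (q - p)" using su by simp
  then have "collinear {0, q - p, r - p}" by (auto simp: collinear_lemma)
  then have "collinear {q, p, r}" using collinear_3[of q p r] by simp
  then show False using assms by (simp add: insert_commute)
qed

lemma triangle_plane_convex:
  assumes gp: "general_position T" and T: "card T = 3"
  shows "complete_graph T \<in> \<P>\<^sup>* (cycle_graph 3)"
proof -
  have fin: "finite T" using T by (simp add: card_ge_0_finite)
  obtain a b c where abc: "T = {a, b, c}" "a \<noteq> b" "b \<noteq> c" "a \<noteq> c" using T by (auto simp: card_3_iff)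
  have ncol: "\<not> collinear {p, q, r}" if "p \<in> T" "q \<in> T" "r \<in> T" "p \<noteq> q" "q \<noteq> r" "p \<noteq> r" for p q r
    using gp that by (auto simp: general_position_def)
  have nc: "\<not> crossing e e'" if e: "e \<subseteq> T" "card e = 2" "e' \<subseteq> T" "card e' = 2" for e e'
  proof
    assume "crossing e e'"
    then obtain p q r s where pq: "e \<noteq> e'" "e = {p, q}" "e' = {r, s}"
      "open_segment p q \<inter> open_segment r s \<noteq> {}" unfolding crossing_def by blast
    have ne: "p \<noteq> q" "r \<noteq> s" using e pq by auto
    \<comment> \<open>Two edges on three vertices share an endpoint, and edges with a common
      endpoint do not cross in general position.\<close>
    have "card (e \<union> e') \<le> 3" using card_mono[OF fin, of "e \<union> e'"] e T by simp
    then have "p = r \<or> p = s \<or> q = r \<or> q = s"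
      using ne pq by (auto simp: card_insert_if split: if_splits)
    moreover have False if xyz: "e = {x, y}" "e' = {x, z}" "open_segment x y \<inter> open_segment x z \<noteq> {}" for x y z
    proof -
      have "x \<noteq> y" "x \<noteq> z" using e(2,4) xyz(1,2) by auto
      moreover have "y \<noteq> z" using pq(1) xyz(1,2) by blast
      moreover have "x \<in> T" "y \<in> T" "z \<in> T" using e(1,3) xyz(1,2) by auto
      ultimately show False using adjacent_open_segments_disjoint[OF ncol] xyz(3) by blast
    qed
    ultimately show False
      using pq(2-4) open_segment_commute[of q p] open_segment_commute[of s r] insert_commute[of p q] insert_commute[of r s] by metis
  qed
  have "\<not> affine_dependent T"
    using ncol[of a b c] abc affine_dependent_imp_collinear_3 by auto
  then have "strictly_convex_position T"
    by (simp add: strictly_convex_position_def extreme_point_of_convex_hull_affine_independent)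
  moreover have "isomorphic (complete_graph T) (cycle_graph 3)"
  proof -
    obtain f :: "point \<Rightarrow> nat" where "bij_betw f T {0..<3}" using ex_bij_betw_finite_nat[OF fin] T by auto
    then show ?thesis unfolding cycle_graph_3 by (intro isomorphic_complete_graph) (simp add: lessThan_atLeast0)
  qed
  ultimately show ?thesis
    using gp nc fin by (auto simp: plane_convex_drawings_def plane_graph_def geometric_graph_def
        simple_complete_graph)
qed

section \<open>Zero-sum triples modulo n\<close>

definition zero_sum_triples :: "nat \<Rightarrow> nat set set" where
  "zero_sum_triples n = {T. T \<subseteq> {..<n} \<and> card T = 3 \<and> n dvd \<Sum>T}"

text \<open>Subtraction truncates, so both differences are taken; each is a multiple of
  \<open>n\<close> below \<open>n\<close>, hence 0.\<close>

lemma dvd_add_unique: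
  fixes n :: nat
  assumes "n dvd a + y" "n dvd a + z" "y < n" "z < n"
  shows "y = z"
proof -
  have "n dvd z - y" "n dvd y - z"
    using dvd_diff_nat[OF assms(2,1)] dvd_diff_nat[OF assms(1,2)] by simp_all
  then show ?thesis using assms(3,4) by (metis diff_is_0_eq le_antisym less_imp_diff_less nat_dvd_not_less neq0_conv)
qed

lemma finite_zero_sum_triples: "finite (zero_sum_triples n)"
  by (rule finite_subset[of _ "Pow {..<n}"]) (auto simp: zero_sum_triples_def)

lemma zero_sum_triples_eqI:
  assumes "T \<in> zero_sum_triples n" "T' \<in> zero_sum_triples n" "e \<subseteq> T" "e \<subseteq> T'" "card e = 2"
  shows "T = T'"
proof -
  have third: "\<exists>z. U = insert z e \<and> z < n \<and> n dvd \<Sum>e + z" if "U \<in> zero_sum_triples n" "e \<subseteq> U" for U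
  proof -
    have U: "U \<subseteq> {..<n}" "card U = 3" "n dvd \<Sum>U" using that by (auto simp: zero_sum_triples_def)
    then have fin: "finite U" "finite e" using assms(5) by (simp_all add: card_ge_0_finite)
    then have "card (U - e) = 1" using U that assms(5) by (simp add: card_Diff_subset)
    then obtain z where z: "U - e = {z}" by (auto simp: card_1_singleton_iff)
    then have "U = insert z e" "z \<notin> e" using that by auto
    then show ?thesis using U fin by (intro exI[of _ z]) (auto simp: add.commute)
  qed
  obtain z z' where "T = insert z e" "z < n" "n dvd \<Sum>e + z" "T' = insert z' e" "z' < n" "n dvd \<Sum>e + z'"
    using third[of T] third[of T'] assms by blast
  then show ?thesis using dvd_add_unique by metis
qed

text \<open>A pair \<open>{x, y}\<close> extends to a triple unless the third element \<open>-x-y\<close> is \<open>x\<close> or \<open>y\<close>, that is,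
  unless the pair has the form \<open>{x, -2x}\<close>.\<close>

lemma card_zero_sum_triples: "n choose 2 \<le> 3 * card (zero_sum_triples n) + n"
proof -
  \<comment> \<open>\<open>c x\<close> is the residue of -2x. The description is evaluated only
    where a suitable \<open>y\<close> is at hand.\<close>
  define c where "c x = (THE y. y < n \<and> n dvd (x + x) + y)" for x
  have c: "c x = y" if "y < n" "n dvd (x + x) + y" for x y
    unfolding c_def using that by (intro the_equality) (auto intro: dvd_add_unique)
  let ?pairs = "\<lambda>T :: nat set. {e. e \<subseteq> T \<and> card e = 2}"
  have "?pairs {..<n} \<subseteq> (\<Union>T\<in>zero_sum_triples n. ?pairs T) \<union> (\<lambda>x. {x, c x}) ` {..<n}"
  proof
    fix e assume "e \<in> ?pairs {..<n}"
    then obtain x y where e: "e = {x, y}" "x \<noteq> y" "x < n" "y < n" by (auto simp: card_2_iff)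
    \<comment> \<open>The residue of -x-y; \<open>2 * n\<close> keeps the natural subtraction from
      truncating.\<close>
    define z where "z = (2 * n - x - y) mod n"
    have z: "z < n" using e by (simp add: z_def)
    have "(x + y + z) mod n = (x + y + (2 * n - x - y)) mod n" by (simp add: z_def mod_add_right_eq)
    also have "\<dots> = 0" using e by simp
    finally have dvd: "n dvd x + y + z" by auto
    consider "z = x" | "z = y" | "z \<noteq> x" "z \<noteq> y" by blast
    then show "e \<in> (\<Union>T\<in>zero_sum_triples n. ?pairs T) \<union> (\<lambda>x. {x, c x}) ` {..<n}"
    proof cases
      case 1
      then have "c x = y" using dvd e by (intro c) (simp_all add: ac_simps)
      then show ?thesis using e by auto
    next
      case 2
      then have "c y = x" using dvd e by (intro c) (simp_all add: ac_simps)
      then have "e = {y, c y}" using e by auto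
      then show ?thesis using e by blast
    next
      case 3
      then have "{x, y, z} \<in> zero_sum_triples n"
        using e z dvd by (simp add: zero_sum_triples_def ac_simps)
      moreover have "e \<in> ?pairs {x, y, z}" using e by auto
      ultimately show ?thesis by blast
    qed
  qed
  then have "card (?pairs {..<n}) \<le> card ((\<Union>T\<in>zero_sum_triples n. ?pairs T) \<union> (\<lambda>x. {x, c x}) ` {..<n})"
    by (rule card_mono[rotated]) (auto simp: finite_zero_sum_triples zero_sum_triples_def
        intro!: finite_subset[of _ "Pow {..<n}"])
  also have "\<dots> \<le> card (\<Union>T\<in>zero_sum_triples n. ?pairs T) + card ((\<lambda>x. {x, c x}) ` {..<n})"
    by (rule card_Un_le)
  also have "\<dots> \<le> (\<Sum>T\<in>zero_sum_triples n. card (?pairs T)) + n"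
    using card_UN_le[OF finite_zero_sum_triples] card_image_le[of "{..<n}"] by (intro add_mono) auto
  also have "(\<Sum>T\<in>zero_sum_triples n. card (?pairs T)) = (\<Sum>T\<in>zero_sum_triples n. 3)"
  proof (rule sum.cong)
    fix T assume "T \<in> zero_sum_triples n"
    then have "card T = 3" "finite T" by (auto simp: zero_sum_triples_def card_ge_0_finite)
    then show "card (?pairs T) = 3" by (simp add: n_subsets eval_nat_numeral)
  qed simp
  finally show ?thesis by (simp add: n_subsets)
qed

text \<open>The numbering \<open>v\<close> of the points is arbitrary: in general position every
  triple is a plane strictly convex triangle, so only the arithmetic modulo \<open>n\<close>
  matters.\<close>

lemma triangle_packing_exists:
  assumes D: "complete_drawing n D"
  shows "n choose 2 \<le> 3 * packing_number D (\<P>\<^sup>* (cycle_graph 3)) + n"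
proof -
  define V where "V = verts D"
  have DV: "D = complete_graph V" using complete_drawing_eq[OF D] by (simp add: V_def)
  have V: "finite V" "card V = n" "general_position V" and simple: "simple_graph D"
    using D unfolding complete_drawing_def geometric_graph_def simple_graph_def V_def by blast+
  obtain v where v: "bij_betw v {..<n} V"
    using ex_bij_betw_nat_finite[OF V(1)] V(2) by (auto simp: lessThan_atLeast0)
  then have inj: "inj_on v {..<n}" and im: "v ` {..<n} = V" by (auto simp: bij_betw_def)
  define P where "P = (\<lambda>T. complete_graph (v ` T)) ` zero_sum_triples n"
  have T: "T \<subseteq> {..<n}" "v ` T \<subseteq> V" "card (v ` T) = 3" "finite T" if "T \<in> zero_sum_triples n" for T
    using that im card_image[OF inj_on_subset[OF inj]] finite_subset[of T "{..<n}"]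
    by (auto simp: zero_sum_triples_def)
  have eqI: "T = T'" if TT: "T \<in> zero_sum_triples n" "T' \<in> zero_sum_triples n"
    and e: "e \<subseteq> v ` T" "e \<subseteq> v ` T'" "card e = 2" for T T' e
  proof -
    have eq: "v ` (T \<inter> T') = v ` T \<inter> v ` T'" using inj_on_image_Int[OF inj] T TT by blast
    then obtain d where d: "d \<subseteq> T \<inter> T'" "e = v ` d" using e by (metis Int_greatest subset_imageE)
    moreover have "card d = 2"
      using card_image[OF inj_on_subset[OF inj], of d] d e T(1)[OF TT(1)] by force
    ultimately show ?thesis using zero_sum_triples_eqI[OF TT, of d] by auto
  qed
  have "is_packing (\<P>\<^sup>* (cycle_graph 3)) D P"
    unfolding is_packing_def
  proof (intro conjI ballI pairwiseI)
    fix F assume "F \<in> P"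
    then obtain U where U: "U \<in> zero_sum_triples n" "F = complete_graph (v ` U)" by (auto simp: P_def)
    show "subgraph F D" unfolding subgraph_def
      using U T[OF U(1)] simple_complete_graph[of "v ` U"] by (auto simp: DV)
    have "general_position (v ` U)" using V(3) T(2)[OF U(1)] unfolding general_position_def by blast
    then show "\<exists>F'\<in>\<P>\<^sup>* (cycle_graph 3). congruent_graph F F'"
      using triangle_plane_convex T(3)[OF U(1)] congruent_graph_refl U(2) by blast
  next
    fix F F' assume "F \<in> P" "F' \<in> P" "F \<noteq> F'"
    then obtain U U' where U: "U \<in> zero_sum_triples n" "F = complete_graph (v ` U)"
      "U' \<in> zero_sum_triples n" "F' = complete_graph (v ` U')" "U \<noteq> U'" by (auto simp: P_def)
    then show "disjnt (edges F) (edges F')" using eqI[of U U'] by (auto simp: disjnt_iff)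
  qed
  then have "card P \<le> packing_number D (\<P>\<^sup>* (cycle_graph 3))"
    by (rule card_le_packing_number[OF simple])
  moreover have "card P = card (zero_sum_triples n)"
    unfolding P_def
  proof (intro card_image inj_onI)
    fix U U' assume U: "U \<in> zero_sum_triples n" "U' \<in> zero_sum_triples n"
      "complete_graph (v ` U) = complete_graph (v ` U')"
    then have "v ` U = v ` U'" by (simp add: complete_graph_def)
    then show "U = U'" using inj_on_image_eq_iff[OF inj] T(1) U by blast
  qed
  ultimately show ?thesis using card_zero_sum_triples[of n] by simp
qed

lemma card_edges_cycle_graph_3: "card (edges (cycle_graph 3)) = 3"
  unfolding cycle_graph_3 by (simp add: n_subsets eval_nat_numeral)

lemma triangle_packing_le:
  assumes D: "complete_drawing n D"
  shows "3 * packing_number D (\<P>\<^sup>* (cycle_graph 3)) \<le> n choose 2"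
proof -
  have simple: "simple_graph D" using D by (simp add: complete_drawing_def geometric_graph_def)
  obtain P where P: "is_packing (\<P>\<^sup>* (cycle_graph 3)) D P" "card P = packing_number D (\<P>\<^sup>* (cycle_graph 3))"
    using packing_number_attained[OF simple] by blast
  have "3 \<le> card {e \<in> edges F. True}" if F: "F \<in> P" for F
  proof -
    obtain F' where F': "F' \<in> \<P>\<^sup>* (cycle_graph 3)" "congruent_graph F F'" "subgraph F D"
      using P(1) F by (auto simp: is_packing_def)
    then have "isomorphic F (cycle_graph 3)"
      using isomorphic_trans[OF congruent_graph_isomorphic] by (auto simp: plane_convex_drawings_def)
    then have "card (edges F) = 3"
      using isomorphic_card_edges[of F "cycle_graph 3"] F'(3) card_edges_cycle_graph_3
        simple_complete_graph[of "{..<3::nat}"]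
      unfolding subgraph_def cycle_graph_3 by simp
    then show ?thesis by simp
  qed
  then show ?thesis
    using packing_edges_le[OF simple P(1), of 3 "\<lambda>_. True"] P(2) complete_drawing_card_edges[OF D]
    by simp
qed

lemma two_real_choose_2: "2 * real (n choose 2) = real n * (real n - 1)"
proof -
  have "2 * (n choose 2) = n * (n - 1)" unfolding choose_two by (rule dvd_mult_div_cancel) (cases "even n"; simp)
  then have "real (2 * (n choose 2)) = real (n * (n - 1))" by simp
  then show ?thesis by (cases n) (auto simp: algebra_simps)
qed

lemma triangles_geometric_packable:
  "geometric_packable (\<P>\<^sup>* (cycle_graph 3)) (card (edges (cycle_graph 3)))"
  unfolding geometric_packable_def asymptotically_packed_def card_edges_cycle_graph_3
proof (intro allI impI)
  fix D assume D: "\<forall>n\<ge>1. complete_drawing n (D n)"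
  let ?r = "\<lambda>n. real (packing_number (D n) (\<P>\<^sup>* (cycle_graph 3))) * real 3 / real (card (edges (D n)))"
  \<comment> \<open>The at most \<open>n\<close> uncovered edges form a fraction of at most 2 / (n -
    1) of all, which is at most 4 / n for n >= 2.\<close>
  have bounds: "1 - 4 / real n \<le> ?r n \<and> ?r n \<le> 1" if n: "n \<ge> 2" for n
  proof -
    define p where "p = packing_number (D n) (\<P>\<^sup>* (cycle_graph 3))"
    define N where "N = real (n choose 2)"
    have Dn: "complete_drawing n (D n)" using D n by simp
    have "n choose 2 \<le> 3 * p + n" "3 * p \<le> n choose 2"
      using triangle_packing_exists[OF Dn] triangle_packing_le[OF Dn] by (simp_all add: p_def)
    then have p: "N \<le> 3 * real p + real n" "3 * real p \<le> N"
      unfolding N_def by linarith+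
    have N: "2 * N = real n * (real n - 1)" unfolding N_def by (rule two_real_choose_2)
    have "real n * real n \<le> real n * (2 * (real n - 1))" using n by (intro mult_left_mono) auto
    then have nN: "real n * real n \<le> 4 * N" using N by (simp add: algebra_simps)
    have N0: "N > 0" using n by (simp add: N_def zero_less_binomial)
    have "real n / N \<le> 4 / real n" using nN N0 n by (simp add: field_simps)
    moreover have "N / N \<le> (3 * real p + real n) / N" using p(1) N0 by (intro divide_right_mono) auto
    then have "1 - real n / N \<le> 3 * real p / N" using N0 by (simp add: add_divide_distrib)
    ultimately have "1 - 4 / real n \<le> 3 * real p / N" by linarith
    moreover have "3 * real p / N \<le> 1" using p N0 by simp
    ultimately show ?thesis
      using complete_drawing_card_edges[OF Dn] by (simp add: p_def N_def mult.commute)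
  qed
  show "?r \<longlonglongrightarrow> 1"
  proof (rule tendsto_sandwich)
    show "\<forall>\<^sub>F n in sequentially. 1 - 4 / real n \<le> ?r n" "\<forall>\<^sub>F n in sequentially. ?r n \<le> 1"
      using bounds by (auto simp: eventually_sequentially)
    show "(\<lambda>n. 1 - 4 / real n) \<longlonglongrightarrow> 1"
      using tendsto_diff[OF tendsto_const lim_const_over_n[of 4], of 1] by simp
  qed simp
qed


section \<open>A three-chain point set\<close>

text \<open>Cluster 0 lies on a flat parabola arc to the right of the origin; the other two clusters are
  its images under the linear map \<open>(u, v) \<mapsto> (-v, u - v)\<close>, which has order 3 and determinant 1.\<close>

definition chain_point :: "nat \<Rightarrow> real \<Rightarrow> point" where
  "chain_point c t = (let u = 1 + t; v = t\<^sup>2 / 10 in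
     if c = 0 then vector [u, v] else if c = 1 then vector [- v, u - v] else vector [v - u, - u])"

definition height :: "nat \<Rightarrow> real" where
  "height i = 1 / (real (i div 3) + 1)"

text \<open>Indices are dealt to the clusters in turn, so every initial segment is balanced, and one
  infinite sequence with heights in (0, 1] serves all \<open>n\<close>.\<close>

definition three_chain_point :: "nat \<Rightarrow> point" where
  "three_chain_point i = chain_point (i mod 3) (height i)"

section \<open>Orientation signs on the three chains\<close>

lemma orient_chain_next_aux:
  fixes s t r :: real
  assumes "0 < s" "s < t" "t \<le> 1" "0 < r" "r \<le> 1"
  shows "((1 + t) - (1 + s)) * ((1 + r) - r\<^sup>2 / 10 - s\<^sup>2 / 10)
    - (t\<^sup>2 / 10 - s\<^sup>2 / 10) * (- (r\<^sup>2 / 10) - (1 + s)) > 0" (is "?lhs > 0")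
proof -
  have sq: "s\<^sup>2 \<le> 1" "r\<^sup>2 \<le> 1" "0 \<le> r\<^sup>2" using assms by (auto simp: power_le_one)
  have "?lhs = (t - s) * ((1 + r) - r\<^sup>2 / 10 - s\<^sup>2 / 10 + (s / 10 + t / 10) * (r\<^sup>2 / 10 + 1 + s))"
    by (simp add: field_simps power2_eq_square)
  moreover have "(s / 10 + t / 10) * (r\<^sup>2 / 10 + 1 + s) > 0" using assms sq by (intro mult_pos_pos) linarith+
  then have "(1 + r) - r\<^sup>2 / 10 - s\<^sup>2 / 10 + (s / 10 + t / 10) * (r\<^sup>2 / 10 + 1 + s) > 0"
    using assms sq by linarith
  ultimately show ?thesis using assms(2) by simp
qed

lemma orient_chain_prev_aux:
  fixes s t r :: real
  assumes "0 < s" "s < t" "t \<le> 1" "0 < r" "r \<le> 1"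
  shows "((1 + t) - (1 + s)) * (- (1 + r) - s\<^sup>2 / 10)
    - (t\<^sup>2 / 10 - s\<^sup>2 / 10) * ((r\<^sup>2 / 10 - (1 + r)) - (1 + s)) < 0" (is "?lhs < 0")
proof -
  have sq: "0 \<le> r\<^sup>2" "r\<^sup>2 \<le> 1" using assms by (auto simp: power_le_one)
  have "?lhs = (t - s) * (- (1 + r) - s\<^sup>2 / 10 + (s / 10 + t / 10) * (2 + r + s - r\<^sup>2 / 10))"
    by (simp add: field_simps power2_eq_square)
  \<comment> \<open>Here flatness is decisive: the chord has slope (s + t) / 10, at most 1/5, and
    the product stays below 1. This is what the factor 1/10 of the parabola is for.\<close>
  moreover have "(s / 10 + t / 10) * (2 + r + s - r\<^sup>2 / 10) \<le> 1 / 5 * 4"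
    using assms sq by (intro mult_mono) linarith+
  then have "- (1 + r) - s\<^sup>2 / 10 + (s / 10 + t / 10) * (2 + r + s - r\<^sup>2 / 10) < 0"
    using assms zero_le_power2[of s] by linarith
  ultimately show ?thesis using assms(2) by (simp add: mult_less_0_iff)
qed

lemma orient_chain_three_aux:
  fixes s t r :: real
  assumes "0 < s" "s \<le> 1" "0 < t" "t \<le> 1" "0 < r" "r \<le> 1"
  shows "(- (t\<^sup>2 / 10) - (1 + s)) * (- (1 + r) - s\<^sup>2 / 10)
    - ((1 + t) - t\<^sup>2 / 10 - s\<^sup>2 / 10) * ((r\<^sup>2 / 10 - (1 + r)) - (1 + s)) > 0" (is "?lhs > 0")
proof -
  have sq: "0 \<le> s\<^sup>2" "s\<^sup>2 \<le> 1" "0 \<le> t\<^sup>2" "t\<^sup>2 \<le> 1" "0 \<le> r\<^sup>2" "r\<^sup>2 \<le> 1"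
    using assms by (auto simp: power_le_one)
  have "?lhs = (t\<^sup>2 / 10 + (1 + s)) * ((1 + r) + s\<^sup>2 / 10)
    + ((1 + t) - t\<^sup>2 / 10 - s\<^sup>2 / 10) * ((1 + r) + (1 + s) - r\<^sup>2 / 10)"
    by (simp add: field_simps)
  moreover have "(t\<^sup>2 / 10 + (1 + s)) * ((1 + r) + s\<^sup>2 / 10) > 0" using assms sq by (intro mult_pos_pos) linarith+
  moreover have "((1 + t) - t\<^sup>2 / 10 - s\<^sup>2 / 10) * ((1 + r) + (1 + s) - r\<^sup>2 / 10) > 0"
    using assms sq by (intro mult_pos_pos) linarith+
  ultimately show ?thesis by linarith
qed

lemma chain_point_coords:
  "chain_point 0 t $ 1 = 1 + t" "chain_point 0 t $ 2 = t\<^sup>2 / 10"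
  "chain_point 1 t $ 1 = - (t\<^sup>2 / 10)" "chain_point 1 t $ 2 = (1 + t) - t\<^sup>2 / 10"
  "chain_point 2 t $ 1 = t\<^sup>2 / 10 - (1 + t)" "chain_point 2 t $ 2 = - (1 + t)"
  by (simp_all add: chain_point_def Let_def)

text \<open>The turn of the clusters is linear with determinant 1. Together with
  \<open>chain_turn_induct\<close> this reduces each orientation claim to cluster 0.\<close>

lemma orient_turn:
  assumes "c < 3" "d < 3" "e < 3"
  shows "orient (chain_point (Suc c mod 3) s) (chain_point (Suc d mod 3) t) (chain_point (Suc e mod 3) r)
    = orient (chain_point c s) (chain_point d t) (chain_point e r)"
proof -
  have turn: "chain_point (Suc c mod 3) t $ 1 = - (chain_point c t $ 2)"
    "chain_point (Suc c mod 3) t $ 2 = chain_point c t $ 1 - chain_point c t $ 2" if "c < 3" for c t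
  proof -
    from that consider "c = 0" | "c = 1" | "c = 2" by linarith
    then show "chain_point (Suc c mod 3) t $ 1 = - (chain_point c t $ 2)"
      "chain_point (Suc c mod 3) t $ 2 = chain_point c t $ 1 - chain_point c t $ 2"
      by (cases; simp add: chain_point_def Let_def)+
  qed
  show ?thesis unfolding orient_def turn[OF assms(1)] turn[OF assms(2)] turn[OF assms(3)]
    by (simp add: algebra_simps)
qed

lemma chain_turn_induct:
  assumes "c < 3"
    and "P (0 :: nat)" and "\<And>c. c < 3 \<Longrightarrow> P c \<Longrightarrow> P (Suc c mod 3)"
  shows "P c"
proof -
  have "P 1" using assms(3)[of 0] assms(2) by simp
  moreover have "P 2" using assms(3)[of 1] \<open>P 1\<close> by (simp add: numeral_2_eq_2)
  moreover have "c = 0 \<or> c = 1 \<or> c = 2" using assms(1) by linarith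
  ultimately show ?thesis using assms(2) by auto
qed

lemma orient_chain_next:
  assumes "c < 3" "0 < s" "s < t" "t \<le> 1" "0 < r" "r \<le> 1"
  shows "orient (chain_point c s) (chain_point c t) (chain_point (Suc c mod 3) r) > 0"
  using assms(1)
proof (rule chain_turn_induct)
  show "orient (chain_point 0 s) (chain_point 0 t) (chain_point (Suc 0 mod 3) r) > 0"
    using orient_chain_next_aux[OF assms(2-)] by (simp add: orient_def chain_point_coords flip: One_nat_def)
qed (simp add: orient_turn)

lemma orient_chain_prev:
  assumes "c < 3" "0 < s" "s < t" "t \<le> 1" "0 < r" "r \<le> 1"
  shows "orient (chain_point c s) (chain_point c t) (chain_point (Suc (Suc c mod 3) mod 3) r) < 0"
  using assms(1)
proof (rule chain_turn_induct)
  show "orient (chain_point 0 s) (chain_point 0 t) (chain_point (Suc (Suc 0 mod 3) mod 3) r) < 0"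
    using orient_chain_prev_aux[OF assms(2-)]
    by (simp add: orient_def chain_point_coords flip: numeral_2_eq_2)
qed (simp add: orient_turn)

lemma orient_chain_three:
  assumes "c < 3" "0 < s" "s \<le> 1" "0 < t" "t \<le> 1" "0 < r" "r \<le> 1"
  shows "orient (chain_point c s) (chain_point (Suc c mod 3) t) (chain_point (Suc (Suc c mod 3) mod 3) r) > 0"
  using assms(1)
proof (rule chain_turn_induct)
  show "orient (chain_point 0 s) (chain_point (Suc 0 mod 3) t) (chain_point (Suc (Suc 0 mod 3) mod 3) r) > 0"
    using orient_chain_three_aux[OF assms(2-)]
    by (simp add: orient_def chain_point_coords flip: numeral_2_eq_2 One_nat_def)
qed (simp add: orient_turn)

text \<open>On a parabola \<open>orient\<close> is a Vandermonde determinant, so distinct parameters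
  give noncollinear points.\<close>

lemma orient_chain_same:
  assumes "c < 3"
  shows "orient (chain_point c s) (chain_point c t) (chain_point c r) = (t - s) * (r - s) * (r - t) / 10"
  using assms
proof (rule chain_turn_induct)
  show "orient (chain_point 0 s) (chain_point 0 t) (chain_point 0 r) = (t - s) * (r - s) * (r - t) / 10"
    by (simp add: orient_def chain_point_coords field_simps power2_eq_square)
qed (simp add: orient_turn)

lemma height_bounds: "0 < height i" "height i \<le> 1"
  by (simp_all add: height_def)

lemma height_inj: "i mod 3 = j mod 3 \<Longrightarrow> height i = height j \<Longrightarrow> i = j"
  by (simp add: height_def) (metis div_mod_decomp)

lemma orient_three_chain_next:
  assumes "j mod 3 = i mod 3" "l mod 3 = Suc (i mod 3) mod 3" "height i < height j"
  shows "orient (three_chain_point i) (three_chain_point j) (three_chain_point l) > 0"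
  using orient_chain_next[of "i mod 3" "height i" "height j" "height l"] assms height_bounds
  unfolding three_chain_point_def by (simp del: mod_Suc_eq)

lemma orient_three_chain_prev:
  assumes "j mod 3 = i mod 3" "l mod 3 = Suc (Suc (i mod 3) mod 3) mod 3" "height i < height j"
  shows "orient (three_chain_point i) (three_chain_point j) (three_chain_point l) < 0"
  using orient_chain_prev[of "i mod 3" "height i" "height j" "height l"] assms height_bounds
  unfolding three_chain_point_def by (simp del: mod_Suc_eq)

lemma orient_three_chain_three:
  assumes "j mod 3 = Suc (i mod 3) mod 3" "l mod 3 = Suc (Suc (i mod 3) mod 3) mod 3"
  shows "orient (three_chain_point i) (three_chain_point j) (three_chain_point l) > 0"
  using orient_chain_three[of "i mod 3" "height i" "height j" "height l"] assms height_bounds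
  unfolding three_chain_point_def by (simp del: mod_Suc_eq)

text \<open>By the number of clusters met: one is the Vandermonde case, two is the separation by
  chords of a chain, three is the orientation of mixed triples.\<close>

lemma orient_three_chain_nonzero:
  assumes "i \<noteq> j" "j \<noteq> l" "i \<noteq> l"
  shows "orient (three_chain_point i) (three_chain_point j) (three_chain_point l) \<noteq> 0"
proof -
  have two: "orient (three_chain_point x) (three_chain_point y) (three_chain_point z) \<noteq> 0"
    if "x mod 3 = y mod 3" "x mod 3 \<noteq> z mod 3" "x \<noteq> y" for x y z
  proof -
    have less: "orient (three_chain_point x) (three_chain_point y) (three_chain_point z) \<noteq> 0"
      if xy: "x mod 3 = y mod 3" "height x < height y" and z: "x mod 3 \<noteq> z mod 3" for x y
    proof -
      have "z mod 3 = Suc (x mod 3) mod 3 \<or> z mod 3 = Suc (Suc (x mod 3) mod 3) mod 3"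
        using Suc_mod_3_cases[of "z mod 3" "x mod 3"] z by simp
      then show ?thesis
        using orient_three_chain_next[of y x z] orient_three_chain_prev[of y x z] xy by force
    qed
    have "height x \<noteq> height y" using height_inj that by blast
    then consider "height x < height y" | "height y < height x" by linarith
    then show ?thesis
      using less[of x y] less[of y x] that orient_swap[of "three_chain_point x" "three_chain_point y"]
      by cases auto
  qed
  consider "i mod 3 = j mod 3" "j mod 3 = l mod 3" | "i mod 3 = j mod 3" "i mod 3 \<noteq> l mod 3"
    | "j mod 3 = l mod 3" "j mod 3 \<noteq> i mod 3" | "l mod 3 = i mod 3" "l mod 3 \<noteq> j mod 3"
    | "i mod 3 \<noteq> j mod 3" "j mod 3 \<noteq> l mod 3" "i mod 3 \<noteq> l mod 3" by metis
  then show ?thesis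
  proof cases
    case 1
    then have "height i \<noteq> height j" "height j \<noteq> height l" "height i \<noteq> height l"
      using height_inj assms by metis+
    then have "(height j - height i) * (height l - height i) * (height l - height j) / 10 \<noteq> 0" by simp
    moreover have "orient (three_chain_point i) (three_chain_point j) (three_chain_point l) =
        (height j - height i) * (height l - height i) * (height l - height j) / 10"
      using orient_chain_same[of "l mod 3"] 1 by (simp only: three_chain_point_def)
    ultimately show ?thesis by metis
  next
    case 2
    then show ?thesis using two[of i j l] assms by simp
  next
    case 3
    then show ?thesis using two[of j l i] assms orient_rotate by metis
  next
    case 4
    then show ?thesis using two[of l i j] assms orient_rotate by metis
  next
    case 5
    have "j mod 3 = Suc (i mod 3) mod 3 \<and> l mod 3 = Suc (Suc (i mod 3) mod 3) mod 3 \<or>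
      l mod 3 = Suc (i mod 3) mod 3 \<and> j mod 3 = Suc (Suc (i mod 3) mod 3) mod 3"
      using Suc_mod_3_cases[of "j mod 3" "i mod 3"] Suc_mod_3_cases[of "l mod 3" "i mod 3"] 5 by auto
    then show ?thesis
      using orient_three_chain_three[of j i l] orient_three_chain_three[of l i j] orient_swap'[of "three_chain_point i" "three_chain_point j" "three_chain_point l"]
      by force
  qed
qed

text \<open>If two indices gave the same point, \<open>orient\<close> would vanish with any third
  index, such as \<open>l\<close>.\<close>

lemma inj_three_chain_point: "inj three_chain_point"
proof (rule injI, rule ccontr)
  fix i j assume ij: "three_chain_point i = three_chain_point j" "i \<noteq> j"
  define l where "l = Suc (max i j)"
  have "j \<noteq> l" "i \<noteq> l" unfolding l_def by (metis max.cobounded1 max.cobounded2 Suc_n_not_le_n)+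
  then show False using orient_three_chain_nonzero[OF ij(2)] ij(1) by (fastforce simp: orient_def)
qed

definition chain_index :: "point \<Rightarrow> nat" where
  "chain_index = inv three_chain_point"

lemma chain_index_point [simp]: "chain_index (three_chain_point i) = i"
  by (simp add: chain_index_def inj_three_chain_point)

lemma three_chains_points:
  "three_chains (three_chain_point ` {..<n}) (\<lambda>p. chain_index p mod 3) (\<lambda>p. height (chain_index p))"
proof
  fix x y z assume xyz: "x \<in> three_chain_point ` {..<n}" "y \<in> three_chain_point ` {..<n}" "z \<in> three_chain_point ` {..<n}"
  then obtain i j l where ijl: "x = three_chain_point i" "y = three_chain_point j" "z = three_chain_point l" by auto
  show "orient x y z > 0"
    if "chain_index y mod 3 = chain_index x mod 3" "chain_index z mod 3 = Suc (chain_index x mod 3) mod 3"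
      "height (chain_index x) < height (chain_index y)"
    using that orient_three_chain_next[of j i l] by (simp add: ijl del: mod_Suc_eq)
  show "orient x y z < 0"
    if "chain_index y mod 3 = chain_index x mod 3" "chain_index x mod 3 = Suc (chain_index z mod 3) mod 3"
      "height (chain_index x) < height (chain_index y)"
  proof -
    \<comment> \<open>Modulo 3, the predecessor is the successor of the successor.\<close>
    have "l mod 3 = Suc (Suc (i mod 3) mod 3) mod 3"
      using that(2) Suc_mod_3_cycle[of "l mod 3"] by (simp add: ijl del: mod_Suc_eq)
    then show ?thesis
      using that(1,3) orient_three_chain_prev[of j i l] by (simp add: ijl del: mod_Suc_eq)
  qed
  show "orient x y z > 0"
    if "chain_index y mod 3 = Suc (chain_index x mod 3) mod 3" "chain_index z mod 3 = Suc (chain_index y mod 3) mod 3"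
    using that orient_three_chain_three[of j i l] by (simp add: ijl del: mod_Suc_eq)
  show "orient x y z \<noteq> 0" if "x \<noteq> y" "y \<noteq> z" "x \<noteq> z"
    using that orient_three_chain_nonzero[of i j l] by (auto simp: ijl)
qed (auto dest!: height_inj)

definition three_chain_drawing :: "nat \<Rightarrow> point ugraph" where
  "three_chain_drawing n = complete_graph (three_chain_point ` {..<n})"

lemma three_chain_drawing_complete: "complete_drawing n (three_chain_drawing n)"
proof -
  interpret three_chains "three_chain_point ` {..<n}" "\<lambda>p. chain_index p mod 3" "\<lambda>p. height (chain_index p)"
    by (rule three_chains_points)
  have "general_position (three_chain_point ` {..<n})"
    unfolding general_position_def using orient_nonzero orient_collinear by blast
  then show ?thesis
    by (simp add: complete_drawing_def geometric_graph_def three_chain_drawing_def simple_complete_graph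
        card_image inj_on_subset[OF inj_three_chain_point])
qed

text \<open>Bounds the edges from point \<open>m\<close> to earlier points of its cluster: within a
  residue class \<open>j\<close> is determined by \<open>j div 3\<close>.\<close>

lemma card_congruent_below: "card {j. j < m \<and> j mod 3 = m mod 3} \<le> m div 3"
proof -
  have "inj_on (\<lambda>j. j div 3) {j. j < m \<and> j mod 3 = m mod 3}"
    by (rule inj_onI) (metis (mono_tags, lifting) mem_Collect_eq div_mod_decomp)
  moreover have "(\<lambda>j. j div 3) ` {j. j < m \<and> j mod 3 = m mod 3} \<subseteq> {..<m div 3}"
  proof (rule image_subsetI)
    fix j assume "j \<in> {j. j < m \<and> j mod 3 = m mod 3}"
    then have "j < m" "j mod 3 = m mod 3" by auto
    then have "j div 3 < m div 3"
      by (metis div_le_mono div_mod_decomp less_imp_le_nat less_irrefl_nat nat_less_le)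
    then show "j div 3 \<in> {..<m div 3}" by simp
  qed
  ultimately have "card {j. j < m \<and> j mod 3 = m mod 3} \<le> card {..<m div 3}" by (intro card_inj_on_le) auto
  then show ?thesis by simp
qed

lemma sum_div_3_le: "6 * (\<Sum>m<n. m div 3) \<le> n * (n - 1 :: nat)"
proof (induction n)
  case (Suc n)
  \<comment> \<open>\<open>2 * n\<close> is the increment of \<open>n * (n - 1)\<close> from
    \<open>n\<close> to \<open>Suc n\<close>.\<close>
  have "6 * (n div 3) \<le> 2 * n" by simp
  then show ?case using Suc by (cases n) (auto simp: algebra_simps)
qed simp

text \<open>The factor 6 expresses one third of the n (n - 1) / 2 edges without division.\<close>

lemma three_chain_monochrome_edges:
  "6 * card {e \<in> edges (three_chain_drawing n). three_chains.monochrome (\<lambda>p. chain_index p mod 3) e} \<le> n * (n - 1)"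
proof -
  interpret three_chains "three_chain_point ` {..<n}" "\<lambda>p. chain_index p mod 3" "\<lambda>p. height (chain_index p)"
    by (rule three_chains_points)
  \<comment> \<open>Each inside edge is recorded once, with the larger index first.\<close>
  let ?M = "SIGMA m:{..<n}. {j. j < m \<and> j mod 3 = m mod 3}"
  have "{e \<in> edges (three_chain_drawing n). monochrome e}
    \<subseteq> (\<lambda>(m, j). {three_chain_point m, three_chain_point j}) ` ?M"
  proof
    fix e assume e: "e \<in> {e \<in> edges (three_chain_drawing n). monochrome e}"
    then obtain x y where xy: "e = {x, y}" "x \<noteq> y" by (auto simp: three_chain_drawing_def card_2_iff)
    moreover have "e \<subseteq> three_chain_point ` {..<n}" using e by (simp add: three_chain_drawing_def)
    ultimately obtain i j where ij: "e = {three_chain_point i, three_chain_point j}" "i < n" "j < n" "i \<noteq> j"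
      by blast
    then have eq: "i mod 3 = j mod 3" using e by (simp add: monochrome_doubleton)
    consider "i < j" | "j < i" using ij(4) by linarith
    then show "e \<in> (\<lambda>(m, j). {three_chain_point m, three_chain_point j}) ` ?M"
    proof cases
      case 1
      then show ?thesis using ij eq by (intro image_eqI[of _ _ "(j, i)"]) auto
    next
      case 2
      then show ?thesis using ij eq by (intro image_eqI[of _ _ "(i, j)"]) auto
    qed
  qed
  then have "card {e \<in> edges (three_chain_drawing n). monochrome e} \<le> card ?M"
    by (rule surj_card_le[rotated]) (auto intro!: finite_SigmaI)
  also have "\<dots> = (\<Sum>m<n. card {j. j < m \<and> j mod 3 = m mod 3})" by (simp add: card_SigmaI)
  also have "\<dots> \<le> (\<Sum>m<n. m div 3)" by (intro sum_mono card_congruent_below)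
  finally show ?thesis using sum_div_3_le[of n] by linarith
qed


section \<open>Hamiltonian graphs other than the triangle\<close>

lemma hamiltonian_cycle:
  assumes "hamiltonian G"
  obtains k w where "k \<ge> 3" "bij_betw w {..<k} (verts G)" "\<And>i. i < k \<Longrightarrow> {w i, w (Suc i mod k)} \<in> edges G"
proof -
  obtain C k where C: "k \<ge> 3" "subgraph C G" "verts C = verts G" "isomorphic C (cycle_graph k)"
    using assms by (auto simp: hamiltonian_def)
  obtain w where w: "bij_betw w {..<k} (verts C)"
    "\<And>i j. i < k \<Longrightarrow> j < k \<Longrightarrow> {i, j} \<in> edges (cycle_graph k) \<longleftrightarrow> {w i, w j} \<in> edges C"
    using isomorphic_sym[OF C(4)] by (auto simp: isomorphic_def cycle_graph_def)
  have "{w i, w (Suc i mod k)} \<in> edges G" if "i < k" for i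
  proof -
    have "{i, Suc i mod k} \<in> edges (cycle_graph k)" using that by (auto simp: cycle_graph_def)
    then show ?thesis using w(2)[of i "Suc i mod k"] that C(2) by (auto simp: subgraph_def)
  qed
  then show ?thesis using that C(1,3) w(1) by auto
qed

text \<open>A Hamiltonian cycle on three vertices already uses every pair. This excludes k = 3 for
  the remaining graphs.\<close>

lemma hamiltonian_3_isomorphic_cycle:
  assumes G: "simple_graph G" and w: "bij_betw w {..<3 :: nat} (verts G)"
    and e: "\<And>i. i < 3 \<Longrightarrow> {w i, w (Suc i mod 3)} \<in> edges G"
  shows "isomorphic G (cycle_graph 3)"
proof -
  have "e \<in> edges G" if e': "e \<subseteq> verts G" "card e = 2" for e
  proof -
    obtain x y where xy: "e = {x, y}" "x \<noteq> y" using e' by (auto simp: card_2_iff)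
    then have "x \<in> w ` {..<3}" "y \<in> w ` {..<3}" using e' w by (auto simp: bij_betw_def)
    then obtain i j where ij: "i < 3" "j < 3" "x = w i" "y = w j" by auto
    then have "i \<noteq> j" using xy by auto
    then have "{i, j} \<subseteq> {..<3}" "card {i, j} = 2" using ij by auto
    then have "{i, j} \<in> edges (cycle_graph 3)" unfolding cycle_graph_3 by simp
    then obtain l where l: "l < 3" "{i, j} = {l, Suc l mod 3}" by (auto simp: cycle_graph_def)
    have "e = w ` {i, j}" using xy ij by auto
    then have "e = {w l, w (Suc l mod 3)}" using l by simp
    then show ?thesis using e l by simp
  qed
  then have "edges G = {e. e \<subseteq> verts G \<and> card e = 2}" using G by (auto simp: simple_graph_def)
  then have "G = complete_graph (verts G)" by (cases G) (simp add: complete_graph_def)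
  then show ?thesis
    using isomorphic_complete_graph[OF bij_betw_inv_into[OF w]] cycle_graph_3 by metis
qed

text \<open>The congruence \<open>f\<close> from \<open>F\<close> to \<open>F'\<close> is affine and
  injective, so a crossing in \<open>F\<close>, or a vertex in the hull of three others, would be
  carried to \<open>F'\<close>.\<close>

lemma plane_convex_copy:
  assumes G: "simple_graph G" "hamiltonian G" "\<not> isomorphic G (cycle_graph 3)"
    and F: "congruent_graph F F'" "F' \<in> \<P>\<^sup>* G" "subgraph F (three_chain_drawing n)"
  shows "\<exists>w k. plane_hamiltonian_copy (three_chain_point ` {..<n}) (\<lambda>p. chain_index p mod 3)
    (\<lambda>p. height (chain_index p)) (verts F) (edges F) w k"
proof -
  obtain k w where w: "k \<ge> 3" "bij_betw w {..<k} (verts G)" "\<And>i. i < k \<Longrightarrow> {w i, w (Suc i mod k)} \<in> edges G"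
    using hamiltonian_cycle[OF G(2)] by blast
  have k: "k \<ge> 4" using hamiltonian_3_isomorphic_cycle[OF G(1), of w] w G(3) by (cases "k = 3") auto
  have F': "plane_graph F'" "isomorphic F' G" "strictly_convex_position (verts F')"
    using F(2) by (auto simp: plane_convex_drawings_def)
  have "isomorphic G F" using isomorphic_sym isomorphic_trans congruent_graph_isomorphic F(1) F'(2) by blast
  then obtain g where g: "bij_betw g (verts G) (verts F)"
    "\<And>u v. u \<in> verts G \<Longrightarrow> v \<in> verts G \<Longrightarrow> {u, v} \<in> edges G \<longleftrightarrow> {g u, g v} \<in> edges F"
    by (auto simp: isomorphic_def)
  obtain A t f where f: "rotation_matrix A" "f = (\<lambda>x. A *v x + t)"
    and eqs: "verts F' = f ` verts F" "edges F' = (`) f ` edges F"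
    using F(1) by (auto simp: congruent_graph_def Let_def)
  have inj: "inj f" using rotation_affine_inj f by simp
  have f_comb: "f (a *\<^sub>R x + b *\<^sub>R y) = a *\<^sub>R f x + b *\<^sub>R f y" if "a + b = 1" for a b x y
  proof -
    have "a *\<^sub>R t + b *\<^sub>R t = t" using that by (metis scaleR_add_left scaleR_one)
    then show ?thesis
      by (simp add: f(2) matrix_vector_right_distrib scaleR_matrix_vector_assoc matrix_scaleR_vector_ac algebra_simps)
  qed
  show ?thesis
  proof (intro exI)
    interpret three_chains "three_chain_point ` {..<n}" "\<lambda>p. chain_index p mod 3" "\<lambda>p. height (chain_index p)"
      by (rule three_chains_points)
    show "plane_hamiltonian_copy (three_chain_point ` {..<n}) (\<lambda>p. chain_index p mod 3)
      (\<lambda>p. height (chain_index p)) (verts F) (edges F) (g \<circ> w) k"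
    proof
      show "verts F \<subseteq> three_chain_point ` {..<n}"
        using F(3) by (simp add: subgraph_def three_chain_drawing_def)
      show "e \<subseteq> verts F \<and> card e = 2" if "e \<in> edges F" for e
        using F(3) that by (auto simp: subgraph_def simple_graph_def)
      show "open_segment a b \<inter> open_segment c d = {}"
        if e: "{a, b} \<in> edges F" "{c, d} \<in> edges F" and ne: "a \<noteq> c" "a \<noteq> d" "b \<noteq> c" "b \<noteq> d" for a b c d
      proof (rule ccontr)
        assume "open_segment a b \<inter> open_segment c d \<noteq> {}"
        then obtain p where p: "p \<in> open_segment a b" "p \<in> open_segment c d" by auto
        have img: "f p \<in> open_segment (f x) (f y)" if pxy: "p \<in> open_segment x y" for x y
        proof -
          obtain u where u: "x \<noteq> y" "0 < u" "u < 1" "p = (1 - u) *\<^sub>R x + u *\<^sub>R y" using pxy by (auto simp: in_segment)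
          then have "f p = (1 - u) *\<^sub>R f x + u *\<^sub>R f y" using f_comb by simp
          moreover have "f x \<noteq> f y" using inj u(1) by (simp add: inj_eq)
          ultimately show ?thesis using u by (auto simp: in_segment)
        qed
        have "open_segment (f a) (f b) \<inter> open_segment (f c) (f d) \<noteq> {}" using img p by blast
        moreover have "f a \<noteq> f c" "f a \<noteq> f d" using inj ne by (simp_all add: inj_eq)
        then have "{f a, f b} \<noteq> {f c, f d}" by (metis doubleton_eq_iff)
        ultimately have "crossing {f a, f b} {f c, f d}" unfolding crossing_def
          by (intro conjI exI[of _ "f a"] exI[of _ "f b"] exI[of _ "f c"] exI[of _ "f d"] refl)
        moreover have "{f a, f b} \<in> edges F'" "{f c, f d} \<in> edges F'"
          using imageI[OF e(1), of "(`) f"] imageI[OF e(2), of "(`) f"] by (simp_all add: eqs)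
        ultimately show False using F'(1) by (auto simp: plane_graph_def)
      qed
      show "x \<notin> convex hull {a, b, c}"
        if x: "x \<in> verts F" "a \<in> verts F" "b \<in> verts F" "c \<in> verts F" "x \<notin> {a, b, c}" for x a b c
      proof
        assume "x \<in> convex hull {a, b, c}"
        then obtain u v r where uvr: "0 \<le> u" "0 \<le> v" "0 \<le> r" "u + v + r = 1" "x = u *\<^sub>R a + v *\<^sub>R b + r *\<^sub>R c"
          by (auto simp: convex_hull_3)
        have "u *\<^sub>R t + v *\<^sub>R t + r *\<^sub>R t = t" using uvr(4) by (metis scaleR_add_left scaleR_one)
        then have "f x = u *\<^sub>R f a + v *\<^sub>R f b + r *\<^sub>R f c"
          by (simp add: f(2) uvr(5) matrix_vector_right_distrib scaleR_matrix_vector_assoc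
              matrix_scaleR_vector_ac algebra_simps)
        then have in_hull: "f x \<in> convex hull {f a, f b, f c}"
          unfolding convex_hull_3 using uvr by blast
        \<comment> \<open>Removing an extreme point leaves the hull convex, so the hull of three
          other vertices avoids \<open>f x\<close>.\<close>
        let ?K = "convex hull (verts F')"
        have "f x extreme_point_of ?K" using F'(3) x(1) by (simp add: strictly_convex_position_def eqs)
        then have "convex (?K - {f x})" using extreme_point_of_stillconvex[of ?K] by simp
        moreover have "{f a, f b, f c} \<subseteq> ?K - {f x}"
          using x inj hull_subset[of "verts F'" convex] by (auto simp: eqs inj_eq intro: hull_inc)
        ultimately have "convex hull {f a, f b, f c} \<subseteq> ?K - {f x}" by (intro hull_minimal)
        then show False using in_hull by auto
      qed
      show "bij_betw (g \<circ> w) {..<k} (verts F)" using bij_betw_trans w(2) g(1) by blast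
      show "{(g \<circ> w) i, (g \<circ> w) (Suc i mod k)} \<in> edges F" if "i < k" for i
        using w(3)[OF that] g(2)[of "w i" "w (Suc i mod k)"] bij_betw_apply[OF w(2)] that by auto
    qed (rule k)
  qed
qed

text \<open>If \<open>G\<close> has no drawing in strictly convex position, only the empty packing
  exists and the same argument covers it.\<close>

lemma three_chain_packing_bound:
  assumes G: "simple_graph G" "hamiltonian G" "\<not> isomorphic G (cycle_graph 3)"
  shows "12 * packing_number (three_chain_drawing n) (\<P>\<^sup>* G) * card (edges G) \<le> 5 * (n * (n - 1))"
proof -
  interpret three_chains "three_chain_point ` {..<n}" "\<lambda>p. chain_index p mod 3" "\<lambda>p. height (chain_index p)"
    by (rule three_chains_points)
  let ?D = "three_chain_drawing n"
  have simple: "simple_graph ?D" by (simp add: three_chain_drawing_def simple_complete_graph)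
  obtain P where P: "is_packing (\<P>\<^sup>* G) ?D P" "card P = packing_number ?D (\<P>\<^sup>* G)"
    using packing_number_attained[OF simple] by blast
  \<comment> \<open>2/5 of the edges, rounded up to a natural number as
    \<open>packing_edges_le\<close> requires.\<close>
  define m where "m = (2 * card (edges G) + 4) div 5"
  have "m \<le> card {e \<in> edges F. monochrome e}" if F: "F \<in> P" for F
  proof -
    obtain F' where F': "F' \<in> \<P>\<^sup>* G" "congruent_graph F F'" and sub: "subgraph F ?D"
      using P(1) F by (auto simp: is_packing_def)
    have "isomorphic F G"
      using isomorphic_trans[OF congruent_graph_isomorphic] F' by (auto simp: plane_convex_drawings_def)
    then have "card (edges F) = card (edges G)"
      using isomorphic_card_edges[of F G] sub G(1) by (simp add: subgraph_def)
    moreover have "card (edges F) = card {e \<in> edges F. monochrome e} + card {e \<in> edges F. \<not> monochrome e}"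
    proof -
      have "card (edges F) = card ({e \<in> edges F. monochrome e} \<union> {e \<in> edges F. \<not> monochrome e})"
        by (rule arg_cong[of _ _ card]) auto
      also have "\<dots> = card {e \<in> edges F. monochrome e} + card {e \<in> edges F. \<not> monochrome e}"
        using finite_edges[of F] sub by (intro card_Un_disjoint) (auto simp: subgraph_def)
      finally show ?thesis .
    qed
    moreover obtain w k where "plane_hamiltonian_copy (three_chain_point ` {..<n}) (\<lambda>p. chain_index p mod 3)
      (\<lambda>p. height (chain_index p)) (verts F) (edges F) w k"
      using plane_convex_copy[OF G F'(2,1) sub] by blast
    then have "2 * card {e \<in> edges F. \<not> monochrome e} \<le> 3 * card {e \<in> edges F. monochrome e}"
      by (rule plane_hamiltonian_copy.cross_le_monochrome)
    ultimately show ?thesis unfolding m_def by linarith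
  qed
  from packing_edges_le[OF simple P(1) this]
  have "packing_number ?D (\<P>\<^sup>* G) * m \<le> card {e \<in> edges ?D. monochrome e}" by (simp add: P(2))
  moreover have "2 * card (edges G) \<le> 5 * m" unfolding m_def by linarith
  then have "packing_number ?D (\<P>\<^sup>* G) * (2 * card (edges G)) \<le> packing_number ?D (\<P>\<^sup>* G) * (5 * m)"
    by (rule mult_le_mono2)
  \<comment> \<open>With p the packing number, e the edges of \<open>G\<close> and M the inside
    edges: 12 p e <= 30 p m <= 30 M <= 5 n (n - 1).\<close>
  ultimately show ?thesis using three_chain_monochrome_edges[of n] by linarith
qed

lemma hamiltonian_not_geometric_packable:
  assumes "simple_graph G" "hamiltonian G" "\<not> isomorphic G (cycle_graph 3)"
  shows "\<not> geometric_packable (\<P>\<^sup>* G) (card (edges G))"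
proof
  assume "geometric_packable (\<P>\<^sup>* G) (card (edges G))"
  then have "asymptotically_packed three_chain_drawing (\<P>\<^sup>* G) (card (edges G))"
    using three_chain_drawing_complete by (simp add: geometric_packable_def)
  then have lim: "(\<lambda>n. real (packing_number (three_chain_drawing n) (\<P>\<^sup>* G)) * real (card (edges G)) /
      real (card (edges (three_chain_drawing n)))) \<longlonglongrightarrow> 1" (is "?r \<longlonglongrightarrow> 1")
    by (simp add: asymptotically_packed_def)
  have "?r n \<le> 5 / 6" if n: "n \<ge> 2" for n
  proof -
    define x where "x = real (packing_number (three_chain_drawing n) (\<P>\<^sup>* G)) * real (card (edges G))"
    define N where "N = real (n choose 2)"
    have "real (12 * packing_number (three_chain_drawing n) (\<P>\<^sup>* G) * card (edges G)) \<le> real (5 * (n * (n - 1)))"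
      using three_chain_packing_bound[OF assms] of_nat_le_iff by blast
    then have "12 * x \<le> 5 * (real n * (real n - 1))" using n by (simp add: x_def of_nat_diff)
    then have "12 * x \<le> 10 * N" using two_real_choose_2[of n] by (simp add: N_def)
    moreover have "N > 0" using n by (simp add: N_def zero_less_binomial)
    ultimately have "x / N \<le> 5 / 6" by (simp add: field_simps)
    then show ?thesis
      using complete_drawing_card_edges[OF three_chain_drawing_complete[of n]] by (simp add: x_def N_def)
  qed
  then have "(1 :: real) \<le> 5 / 6" by (intro LIMSEQ_le_const2[OF lim]) blast
  then show False by simp
qed

theorem theorem3:
  shows "(\<forall>G :: 'a ugraph. simple_graph G \<and> planar G \<and> hamiltonian G \<and> \<not> isomorphic G (cycle_graph 3)
             \<longrightarrow> \<not> geometric_packable (\<P>\<^sup>* G) (card (edges G)))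
         \<and> geometric_packable (\<P>\<^sup>* (cycle_graph 3)) (card (edges (cycle_graph 3)))"
  using hamiltonian_not_geometric_packable triangles_geometric_packable by blast

end
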